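(* Let $K\subset\mathbb{R}^d$ be compact, let $\omega_n\in K$ be rotation vectors converging to $\omega_\infty\in K$, and let $S_j^n$ ($n\in\mathbb{N}$) and $S_j^\infty$ be families of local potentials satisfying (A)–(E) with a common interaction range $r$, such that $\lim_{n\to\infty}\|\nabla S_0^n-\nabla S_0^\infty\|_{C^1(\mathbb{R}^{\mathbb{Z}^d})}=0$. Let $\Gamma_n$ be a ghost circle for the $S_j^n$ with rotation vector $\omega_n$. Then there exist a ghost circle $\Gamma_\infty$ for the $S_j^\infty$ with rotation vector $\omega_\infty$ and a subsequence $(n_m)$ such that $\Gamma_{n_m}\to\Gamma_\infty$. If moreover $S_j^n\to S_j^\infty$ uniformly on $\mathcal{B}_K$ and every $\Gamma_n$ contains a global minimizer for the $S_j^n$, then $\Gamma_\infty$ contains a global minimizer for the $S_j^\infty$.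
   Context: Notation: $\|i\|=\sum_{k=1}^d|i_k|$, $B_j^r=\{k:\|k-j\|\le r\}$, $(\tau_{k,l}x)_i=x_{i+k}+l$. Local potentials $S_j:\mathbb{R}^{\mathbb{Z}^d}\to\mathbb{R}$, $j\in\mathbb{Z}^d$, satisfy: (A) there is $r\in(0,\infty)$ and $C^2$ functions $s_j:\mathbb{R}^{B_j^r}\to\mathbb{R}$ with $S_j(x)=s_j(x|_{B_j^r})$; (B) $S_j(\tau_{k,l}x)=S_{j+k}(x)$; (C) each $S_j$ is bounded below and $S_j(x)\to\infty$ as $|x_k-x_j|\to\infty$ whenever $\|k-j\|=1$; (D) $\partial_{i,k}S_j\le0$ for $i\ne k$, and $\partial_{i,k}S_i<0$ when $\|i-k\|=1$; (E) $|\partial_{i,k}S_j|\le C$ uniformly. For $S(x)=s(x|_B)$, $B$ finite, $s\in C^{m+1}$: $\|\nabla S\|_{C^m(\mathbb{R}^{\mathbb{Z}^d})}=\sum_{1\le k\le m+1}\sum_{j_1,\dots,j_k}\sup_x|\partial_{j_1\dots j_k}S(x)|$. $\mathbb{X}=\{x:\sum_i2^{-\|i\|}|x_i|<\infty\}$; $(\nabla W(x))_i=\sum_{\|j-i\|\le r}\partial_iS_j(x)$; $\Psi_t$ the complete flow of $\dot x=-\nabla W(x)$ on $\mathbb{X}$. Birkhoff configuration: $\tau_{k,l}x\ge x$ or $\tau_{k,l}x\le x$ (pointwise) for all $(k,l)$; rotation vector $\omega$: $\lim_nx_{ni}/n=\langle\omega,i\rangle$; $\mathcal{B}_K$ is the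 set of Birkhoff configurations with rotation vector in $K$. A ghost circle (for given potentials) is a set $\Gamma\subset\mathbb{R}^{\mathbb{Z}^d}$ that is nonempty, closed and connected (pointwise topology), strictly ordered (for $x,y\in\Gamma$: $x\ll y$, $x=y$ or $y\ll x$), shift-invariant, and satisfies $\Psi_t(\Gamma)=\Gamma$ for all $t\in\mathbb{R}$; its elements are Birkhoff with a common rotation vector, the rotation vector of $\Gamma$, and for each $\xi\in\mathbb{R}$ there is a unique $x(\xi)\in\Gamma$ with $x(\xi)_0=\xi$. Ghost circles $\Gamma_n$ converge to $\Gamma_\infty$ if for every $\xi\in\mathbb{R}$, the configurations $x^n(\xi)\in\Gamma_n$ with $x^n(\xi)_0=\xi$ converge pointwise to the configuration $x^\infty(\xi)\in\Gamma_\infty$ with $x^\infty(\xi)_0=\xi$. Global minimizer: $W_B(x+y)\ge W_B(x)$ for every finite $B$ and every $y$ supported in $\mathring{B}^{(r)}=\{i\in B:B_i^r\subset B\}$, $W_B=\sum_{j\in B}S_j$. *)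

theory Defs
  imports "HOL-Analysis.Analysis"
begin

text \<open>Lattice sites are elements of int^'d (the dimension d = CARD('d) is an
arbitrary fixed positive integer); configurations are maps from sites to reals.
The space of configurations carries the product (pointwise) topology.\<close>

type_synonym 'd site = "int ^ 'd"
type_synonym 'd config = "'d site \<Rightarrow> real"

definition lnorm :: "'d::finite site \<Rightarrow> int" where
  "lnorm i = (\<Sum>k\<in>UNIV. \<bar>i $ k\<bar>)"

definition lball :: "'d::finite site \<Rightarrow> real \<Rightarrow> 'd site set" where
  "lball j r = {k. real_of_int (lnorm (k - j)) \<le> r}"

definition tau :: "'d::finite site \<Rightarrow> int \<Rightarrow> 'd config \<Rightarrow> 'd config" where
  "tau k l x = (\<lambda>i. x (i + k) + real_of_int l)"

definition pd :: "'d::finite site \<Rightarrow> ('d config \<Rightarrow> real) \<Rightarrow> 'd config \<Rightarrow> real" where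
  "pd i F x = deriv (\<lambda>t. F (x(i := x i + t))) 0"

text \<open>Twice continuously differentiable (for a function of finitely many coordinates:
all first and second partials exist and the second partials are continuous).\<close>
definition C2_fun :: "('d::finite config \<Rightarrow> real) \<Rightarrow> bool" where
  "C2_fun F \<longleftrightarrow>
     (\<forall>i x. (\<lambda>t. F (x(i := x i + t))) differentiable (at 0)) \<and>
     (\<forall>i k x. (\<lambda>t. pd i F (x(k := x k + t))) differentiable (at 0)) \<and>
     (\<forall>i k. continuous_on UNIV (pd k (pd i F)))"

definition local_potentials :: "real \<Rightarrow> ('d::finite site \<Rightarrow> 'd config \<Rightarrow> real) \<Rightarrow> bool" where
  "local_potentials r S \<longleftrightarrow>
     0 < r \<and>
     \<comment> \<open>(A)\<close>
     (\<forall>j x y. (\<forall>k\<in>lball j r. x k = y k) \<longrightarrow> S j x = S j y) \<and>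
     (\<forall>j. C2_fun (S j)) \<and>
     \<comment> \<open>(B)\<close>
     (\<forall>j k l x. S j (tau k l x) = S (j + k) x) \<and>
     \<comment> \<open>(C)\<close>
     (\<forall>j. \<exists>c. \<forall>x. c \<le> S j x) \<and>
     (\<forall>j k. lnorm (k - j) = 1 \<longrightarrow>
        (\<forall>M. \<exists>R. \<forall>x. R \<le> \<bar>x k - x j\<bar> \<longrightarrow> M \<le> S j x)) \<and>
     \<comment> \<open>(D)\<close>
     (\<forall>i k j x. i \<noteq> k \<longrightarrow> pd k (pd i (S j)) x \<le> 0) \<and>
     (\<forall>i k x. lnorm (i - k) = 1 \<longrightarrow> pd k (pd i (S i)) x < 0) \<and>
     \<comment> \<open>(E)\<close>
     (\<exists>C. \<forall>i k j x. \<bar>pd k (pd i (S j)) x\<bar> \<le> C)"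

text \<open>The C^1 norm of the gradient of a function depending only on the coordinates in B:
sum of sups of first and second partial derivatives (partials outside B vanish).\<close>
definition C1_grad_norm :: "'d::finite site set \<Rightarrow> ('d config \<Rightarrow> real) \<Rightarrow> ereal" where
  "C1_grad_norm B F =
     (\<Sum>j\<in>B. SUP x. ereal \<bar>pd j F x\<bar>) +
     (\<Sum>p\<in>B \<times> B. SUP x. ereal \<bar>pd (snd p) (pd (fst p) F) x\<bar>)"

definition Xweight :: "'d::finite site \<Rightarrow> real" where
  "Xweight i = 2 powr (- real_of_int (lnorm i))"

definition Xspace :: "'d::finite config set" where
  "Xspace = {x. (\<lambda>i. Xweight i * \<bar>x i\<bar>) summable_on UNIV}"

definition Xnorm :: "'d::finite config \<Rightarrow> real" where
  "Xnorm x = (\<Sum>\<^sub>\<infinity>i. Xweight i * \<bar>x i\<bar>)"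

definition gradW :: "real \<Rightarrow> ('d::finite site \<Rightarrow> 'd config \<Rightarrow> real) \<Rightarrow> 'd config \<Rightarrow> 'd config" where
  "gradW r S x = (\<lambda>i. \<Sum>j\<in>lball i r. pd i (S j) x)"

text \<open>gamma is the (global) trajectory of dx/dt = - gradW x in X through x at time 0,
differentiable with respect to the norm of X.\<close>
definition flow_solution ::
  "real \<Rightarrow> ('d::finite site \<Rightarrow> 'd config \<Rightarrow> real) \<Rightarrow> 'd config \<Rightarrow> (real \<Rightarrow> 'd config) \<Rightarrow> bool" where
  "flow_solution r S x \<gamma> \<longleftrightarrow>
     \<gamma> 0 = x \<and> (\<forall>t. \<gamma> t \<in> Xspace) \<and>
     (\<forall>t. ((\<lambda>s. Xnorm (\<lambda>i. \<gamma> s i - \<gamma> t i + (s - t) * gradW r S (\<gamma> t) i) / \<bar>s - t\<bar>)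
            \<longlongrightarrow> 0) (at t))"

text \<open>Psi_t(Gamma) = Gamma for all t: Gamma lies in X, the flow is defined through every
point of Gamma, and every trajectory through a point of Gamma stays in Gamma forever
(forwards and backwards).\<close>
definition flow_invariant ::
  "real \<Rightarrow> ('d::finite site \<Rightarrow> 'd config \<Rightarrow> real) \<Rightarrow> 'd config set \<Rightarrow> bool" where
  "flow_invariant r S \<Gamma> \<longleftrightarrow>
     \<Gamma> \<subseteq> Xspace \<and>
     (\<forall>x\<in>\<Gamma>. \<exists>\<gamma>. flow_solution r S x \<gamma>) \<and>
     (\<forall>x\<in>\<Gamma>. \<forall>\<gamma>. flow_solution r S x \<gamma> \<longrightarrow> (\<forall>t. \<gamma> t \<in> \<Gamma>))"

definition strictly_less :: "'d::finite config \<Rightarrow> 'd config \<Rightarrow> bool" (infix "\<lless>" 50) where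
  "x \<lless> y \<longleftrightarrow> (\<forall>i. x i < y i)"

definition ghost_circle ::
  "real \<Rightarrow> ('d::finite site \<Rightarrow> 'd config \<Rightarrow> real) \<Rightarrow> 'd config set \<Rightarrow> bool" where
  "ghost_circle r S \<Gamma> \<longleftrightarrow>
     \<Gamma> \<noteq> {} \<and> closed \<Gamma> \<and> connected \<Gamma> \<and>
     (\<forall>x\<in>\<Gamma>. \<forall>y\<in>\<Gamma>. x \<lless> y \<or> x = y \<or> y \<lless> x) \<and>
     (\<forall>x\<in>\<Gamma>. \<forall>k l. tau k l x \<in> \<Gamma>) \<and>
     flow_invariant r S \<Gamma>"

definition Birkhoff :: "'d::finite config \<Rightarrow> bool" where
  "Birkhoff x \<longleftrightarrow> (\<forall>k l. (\<forall>i. x i \<le> tau k l x i) \<or> (\<forall>i. tau k l x i \<le> x i))"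

definition lpair :: "real ^ 'd \<Rightarrow> 'd::finite site \<Rightarrow> real" where
  "lpair \<omega> i = (\<Sum>k\<in>UNIV. \<omega> $ k * real_of_int (i $ k))"

definition has_rotation_vector :: "'d::finite config \<Rightarrow> real ^ 'd \<Rightarrow> bool" where
  "has_rotation_vector x \<omega> \<longleftrightarrow>
     (\<forall>i. (\<lambda>n. x (int n *s i) / real n) \<longlonglongrightarrow> lpair \<omega> i)"

definition Birkhoff_set :: "(real ^ 'd) set \<Rightarrow> 'd::finite config set" where
  "Birkhoff_set K = {x. Birkhoff x \<and> (\<exists>\<omega>\<in>K. has_rotation_vector x \<omega>)}"

definition gc_rotation_vector :: "'d::finite config set \<Rightarrow> real ^ 'd \<Rightarrow> bool" where
  "gc_rotation_vector \<Gamma> \<omega> \<longleftrightarrow> (\<forall>x\<in>\<Gamma>. has_rotation_vector x \<omega>)"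

definition gc_point :: "'d::finite config set \<Rightarrow> real \<Rightarrow> 'd config" where
  "gc_point \<Gamma> \<xi> = (THE x. x \<in> \<Gamma> \<and> x 0 = \<xi>)"

definition gc_converges :: "(nat \<Rightarrow> 'd::finite config set) \<Rightarrow> 'd config set \<Rightarrow> bool" where
  "gc_converges \<Gamma> \<Gamma>inf \<longleftrightarrow>
     (\<forall>\<xi> i. (\<lambda>n. gc_point (\<Gamma> n) \<xi> i) \<longlonglongrightarrow> gc_point \<Gamma>inf \<xi> i)"

definition W_B :: "('d::finite site \<Rightarrow> 'd config \<Rightarrow> real) \<Rightarrow> 'd site set \<Rightarrow> 'd config \<Rightarrow> real" where
  "W_B S B x = (\<Sum>j\<in>B. S j x)"

definition global_minimizer ::
  "real \<Rightarrow> ('d::finite site \<Rightarrow> 'd config \<Rightarrow> real) \<Rightarrow> 'd config \<Rightarrow> bool" where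
  "global_minimizer r S x \<longleftrightarrow>
     (\<forall>B y. finite B \<longrightarrow> (\<forall>i. i \<notin> {i\<in>B. lball i r \<subseteq> B} \<longrightarrow> y i = 0) \<longrightarrow>
        W_B S B x \<le> W_B S B (\<lambda>i. x i + y i))"

end

theory Submission
  imports Defs
begin

text \<open>
A ghost circle is parametrised by the value \<open>\<xi>\<close> of its configurations at the site \<open>0\<close>, and all its
configurations stay within distance \<open>1\<close> of a line of slope \<open>\<omega>\<close>, so limits can be taken pointwise. The
crucial point is that different limits never touch. Trajectories inside \<open>\<Gamma> n\<close> exist for all times, are
ordered and are uniformly Lipschitz; their limits are ordered trajectories \<open>\<gamma> \<le> \<eta>\<close> of the limit flow.
If \<open>\<gamma>\<close> and \<open>\<eta>\<close> touch at one site at time \<open>0\<close>, then \<open>\<eta> - \<gamma>\<close> is minimal in time there, so the gradients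
agree at this site, and the twist condition (D) makes \<open>\<gamma>\<close> and \<open>\<eta>\<close> touch at the neighbouring sites, hence
everywhere. By compactness, this non-touching property makes the maps \<open>\<xi> \<mapsto> gc_point (\<Gamma> n) \<xi> i\<close>
asymptotically equicontinuous in \<open>\<xi>\<close>; an Arzela--Ascoli subsequence converges for all \<open>\<xi>\<close>, and its limit
is strictly increasing in \<open>\<xi>\<close>.
\<close>

text \<open>The order inside each circle does not by itself prevent two limits from touching; the
  flow does. Since circles are invariant for negative times too, ordered trajectories stay ordered
  on both sides of time 0, and only this two-sidedness turns a contact into a critical point in
  time. Every estimate that survives the limit must be uniform in \<open>n\<close>, while the bounds
  in (E) may depend on \<open>n\<close>. Gradients of \<open>S n\<close> are therefore compared with
  gradients of \<open>Sinf\<close>, at the cost of a multiple of \<open>\<epsilon> n\<close>, and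
  all uniform Lipschitz estimates use the constant of \<open>Sinf\<close> alone. No existence
  theorem for the limit flow is invoked: its trajectories on the limit circle are limits of
  trajectories. Uniqueness, in contrast, is proved for arbitrary trajectories in
  \<open>Xspace\<close>, because \<open>flow_invariant\<close> quantifies over all of them.
  Equicontinuity can be expected only for large \<open>n\<close>, with a threshold depending on the
  tolerance: the contradiction argument sees the limit potentials and says nothing about an
  individual circle.\<close>

subsection \<open>The lattice\<close>

lemma lnorm_nonneg [simp]: "0 \<le> lnorm i"
  by (simp add: lnorm_def sum_nonneg)

lemma lnorm_zero [simp]: "lnorm 0 = 0"
  by (simp add: lnorm_def)

lemma lnorm_triangle: "lnorm (i + j) \<le> lnorm i + lnorm j"
  by (simp add: lnorm_def flip: sum.distrib) (intro sum_mono abs_triangle_ineq)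

lemma lnorm_minus_commute: "lnorm (i - j) = lnorm (j - i)"
  by (simp add: lnorm_def abs_minus_commute)

lemma abs_component_le_lnorm: "\<bar>i $ k\<bar> \<le> lnorm i"
  unfolding lnorm_def by (rule member_le_sum) auto

lemma finite_vec_box:
  fixes A :: "'a set"
  assumes "finite A"
  shows "finite {v :: 'a ^ 'n::finite. \<forall>k. v $ k \<in> A}"
proof -
  have "{v :: 'a ^ 'n. \<forall>k. v $ k \<in> A} \<subseteq> vec_lambda ` (UNIV \<rightarrow>\<^sub>E A)"
  proof
    fix v :: "'a ^ 'n" assume "v \<in> {v. \<forall>k. v $ k \<in> A}"
    then have "vec_nth v \<in> UNIV \<rightarrow>\<^sub>E A" by auto
    then show "v \<in> vec_lambda ` (UNIV \<rightarrow>\<^sub>E A)"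
      by (metis image_eqI vec_nth_inverse)
  qed
  then show ?thesis
    by (rule finite_subset) (intro finite_imageI finite_PiE finite assms)
qed

lemma finite_lball [simp]: "finite (lball (j :: 'd::finite site) r)"
proof -
  have "finite (lball (0::'d site) r)"
  proof (rule finite_subset)
    show "lball (0::'d site) r \<subseteq> {v. \<forall>k. v $ k \<in> {-\<lfloor>r\<rfloor>..\<lfloor>r\<rfloor>}}"
    proof clarify
      fix v :: "'d site" and k assume "v \<in> lball 0 r"
      then have "lnorm v \<le> \<lfloor>r\<rfloor>" by (simp add: lball_def le_floor_iff)
      with abs_component_le_lnorm[of v k] have "\<bar>v $ k\<bar> \<le> \<lfloor>r\<rfloor>" by linarith
      then show "v $ k \<in> {-\<lfloor>r\<rfloor>..\<lfloor>r\<rfloor>}" by auto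
    qed
  qed (intro finite_vec_box finite_atLeastAtMost_int)
  moreover have "lball j r = (\<lambda>k. k + j) ` lball 0 r"
    by (force simp: lball_def image_iff intro: exI[of _ "_ - j"])
  ultimately show ?thesis by simp
qed

lemma lball_translate: "lball (j + k) r = (\<lambda>i. i + k) ` lball j r"
proof (intro set_eqI iffI)
  fix x assume "x \<in> lball (j + k) r"
  then show "x \<in> (\<lambda>i. i + k) ` lball j r"
    by (intro image_eqI[of _ _ "x - k"]) (auto simp: lball_def algebra_simps)
qed (auto simp: lball_def)

lemma card_lball: "card (lball (j :: 'd::finite site) r) = card (lball (0 :: 'd site) r)"
  proof -
  have "card (lball (0 + j) r) = card (lball (0 :: 'd site) r)"
    unfolding lball_translate by (rule card_image) simp
  then show ?thesis by simp
qed

lemma center_in_lball: "0 \<le> r \<Longrightarrow> i \<in> lball i r"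
  by (simp add: lball_def)

lemma lnorm_step:
  assumes "i \<noteq> j"
  obtains k where "lnorm (k - i) = 1" "lnorm (k - j) = lnorm (i - j) - 1"
proof -
  from assms obtain a where a: "i $ a \<noteq> j $ a" by (auto simp: vec_eq_iff)
  \<comment> \<open>One unit step from \<open>i\<close> towards \<open>j\<close> in a coordinate
    where they differ.\<close>
  define k where "k = (\<chi> b. if b = a then i $ a + sgn (j $ a - i $ a) else i $ b)"
  have "lnorm (k - i) = (\<Sum>b\<in>UNIV. if b = a then 1 else 0)"
    unfolding lnorm_def k_def using a by (intro sum.cong) (auto simp: abs_sgn_eq)
  moreover have "lnorm (k - j) = (\<Sum>b\<in>UNIV. \<bar>(i - j) $ b\<bar> - (if b = a then 1 else 0))"
    unfolding lnorm_def k_def using a by (intro sum.cong) (auto simp: sgn_if)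
  ultimately show ?thesis
    by (intro that[of k]) (simp_all add: lnorm_def sum_subtractf)
qed

lemma neighbour_closed_eq_UNIV:
  assumes "i0 \<in> Z" and "\<And>i k. i \<in> Z \<Longrightarrow> lnorm (k - i) = 1 \<Longrightarrow> k \<in> Z"
  shows "Z = UNIV"
proof -
  have "\<forall>i. nat (lnorm (i - i0)) = n \<longrightarrow> i \<in> Z" for n
  proof (induction n)
    case 0
    have "i = i0" if "nat (lnorm (i - i0)) = 0" for i
    proof (rule ccontr)
      assume "i \<noteq> i0"
      then obtain k where "lnorm (k - i0) = lnorm (i - i0) - 1" using lnorm_step by metis
      with that lnorm_nonneg[of "k - i0"] show False by linarith
    qed
    with assms(1) show ?case by blast
  next
    case (Suc n)
    show ?case
    proof (intro allI impI)
      fix i assume i: "nat (lnorm (i - i0)) = Suc n"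
      then have "i \<noteq> i0" by auto
      then obtain k where k: "lnorm (k - i) = 1" "lnorm (k - i0) = lnorm (i - i0) - 1"
        using lnorm_step by metis
      with i Suc have "k \<in> Z" by auto
      with k(1) show "i \<in> Z" using assms(2) by (simp add: lnorm_minus_commute)
    qed
  qed
  then show ?thesis by blast
qed

subsection \<open>Functions of finitely many coordinates\<close>

text \<open>Exchanging the values site by site reduces estimates in many variables to the
  one-variable mean value theorem, so that partial derivatives suffice.\<close>

definition mix :: "'a set \<Rightarrow> ('a \<Rightarrow> real) \<Rightarrow> ('a \<Rightarrow> real) \<Rightarrow> 'a \<Rightarrow> real" where
  "mix A x y = (\<lambda>k. if k \<in> A then y k else x k)"

lemma mix_empty [simp]: "mix {} x y = x"
  by (simp add: mix_def)

lemma mix_insert: "k \<notin> A \<Longrightarrow> mix (insert k A) x y = (mix A x y)(k := y k)"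
  by (auto simp: mix_def)

lemma coordinate_has_derivative:
  assumes "\<And>x. (\<lambda>t. F (x(i := x i + t))) differentiable (at 0)"
  shows "((\<lambda>t. F (x(i := t))) has_real_derivative pd i F (x(i := t))) (at t)"
proof -
  have "((\<lambda>s. F (x(i := t + s))) has_real_derivative pd i F (x(i := t))) (at 0)"
    using assms[of "x(i := t)"]
    by (simp add: pd_def DERIV_deriv_iff_real_differentiable)
  then show ?thesis
    using DERIV_shift[of "\<lambda>t. F (x(i := t))" _ 0 t] by (simp add: add.commute)
qed

lemma coordinate_mvt:
  assumes "\<And>x. (\<lambda>t. F (x(i := x i + t))) differentiable (at 0)" and "x i \<noteq> b"
  obtains c where "c \<in> closed_segment (x i) b"
    "F (x(i := b)) - F x = (b - x i) * pd i F (x(i := c))"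
proof (cases "x i < b")
  case True
  obtain c where "x i < c" "c < b"
    "F (x(i := b)) - F (x(i := x i)) = (b - x i) * pd i F (x(i := c))"
    using MVT2[OF True, of "\<lambda>t. F (x(i := t))" "\<lambda>t. pd i F (x(i := t))"]
      coordinate_has_derivative[OF assms(1)] by blast
  then show ?thesis by (intro that[of c]) (auto simp: closed_segment_eq_real_ivl)
next
  case False
  with assms(2) have "b < x i" by simp
  then obtain c where "b < c" "c < x i"
    "F (x(i := x i)) - F (x(i := b)) = (x i - b) * pd i F (x(i := c))"
    using MVT2[of b "x i" "\<lambda>t. F (x(i := t))" "\<lambda>t. pd i F (x(i := t))"]
      coordinate_has_derivative[OF assms(1)] by blast
  then show ?thesis by (intro that[of c]) (auto simp: closed_segment_eq_real_ivl algebra_simps)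
qed

text \<open>The intermediate points stay in the box spanned by \<open>x\<close> and
  \<open>y\<close>, so the bound is asked only there. \<open>tendsto_potential\<close> relies on
  this, since no global bound on first partials is available.\<close>

lemma finite_coordinates_mvt:
  assumes "finite B"
    and "\<And>i x. (\<lambda>t. F (x(i := x i + t))) differentiable (at 0)"
    and "\<And>k z. k \<in> B \<Longrightarrow> (\<And>i. z i \<in> closed_segment (x i) (y i)) \<Longrightarrow> \<bar>pd k F z\<bar> \<le> C"
  shows "\<bar>F (mix B x y) - F x\<bar> \<le> C * (\<Sum>k\<in>B. \<bar>y k - x k\<bar>)"
  using assms(1,3)
proof (induction B rule: finite_induct)
  case (insert k A)
  let ?z = "mix A x y"
  have zk: "?z k = x k" using insert.hyps by (simp add: mix_def)
  have "\<bar>F (?z(k := y k)) - F ?z\<bar> \<le> C * \<bar>y k - x k\<bar>"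
  proof (cases "x k = y k")
    case False
    then obtain c where c: "c \<in> closed_segment (x k) (y k)"
      "F (?z(k := y k)) - F ?z = (y k - x k) * pd k F (?z(k := c))"
      using coordinate_mvt[of F k ?z "y k"] assms(2) zk by metis
    have "\<bar>pd k F (?z(k := c))\<bar> \<le> C"
      by (rule insert.prems) (use c(1) in \<open>auto simp: mix_def\<close>)
    then show ?thesis
      using c(2) by (simp add: abs_mult mult.commute[of C] mult_left_mono)
  next
    case True
    then have "?z(k := y k) = ?z" using zk by auto
    with True show ?thesis by simp
  qed
  moreover have "\<bar>F ?z - F x\<bar> \<le> C * (\<Sum>k\<in>A. \<bar>y k - x k\<bar>)"
    by (rule insert.IH) (use insert.prems in auto)
  ultimately show ?case
    using insert.hyps by (simp add: mix_insert distrib_left del: fun_upd_apply)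
qed simp

text \<open>The sign is required only at coordinates that actually move: in the application
  \<open>F\<close> is \<open>pd i (S j)\<close>, and (D) says nothing about its derivative in
  direction \<open>i\<close>.\<close>

lemma finite_coordinates_antimono:
  assumes "finite B"
    and "\<And>i x. (\<lambda>t. F (x(i := x i + t))) differentiable (at 0)"
    and "\<And>k z. k \<in> B \<Longrightarrow> x k \<noteq> y k \<Longrightarrow> pd k F z \<le> 0"
    and "\<And>k. x k \<le> y k"
  shows "F (mix B x y) \<le> F x"
  using assms(1,3)
proof (induction B rule: finite_induct)
  case (insert k A)
  let ?z = "mix A x y"
  have zk: "?z k = x k" using insert.hyps by (simp add: mix_def)
  have "F (?z(k := y k)) \<le> F ?z"
  proof (cases "x k = y k")
    case False
    then obtain c where c: "F (?z(k := y k)) - F ?z = (y k - x k) * pd k F (?z(k := c))"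
      using coordinate_mvt[of F k ?z "y k"] assms(2) zk by metis
    have "(y k - x k) * pd k F (?z(k := c)) \<le> 0"
      using insert.prems(1)[of k] False assms(4)[of k] by (intro mult_nonneg_nonpos) auto
    with c show ?thesis by linarith
  next
    case True
    then have "?z(k := y k) = ?z" using zk by auto
    with True show ?thesis by simp
  qed
  moreover have "F ?z \<le> F x"
    by (rule insert.IH) (use insert.prems in auto)
  ultimately show ?case
    using insert.hyps by (simp add: mix_insert del: fun_upd_apply)
qed simp

subsection \<open>Local potentials\<close>

locale potentials =
  fixes r :: real and S :: "'d::finite site \<Rightarrow> 'd config \<Rightarrow> real" and C :: real
  assumes local_potentials: "local_potentials r S"
    and second_partials_le: "\<bar>pd k (pd i (S j)) x\<bar> \<le> C"
begin

lemma r_pos: "0 < r"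
  using local_potentials by (simp add: local_potentials_def)

lemma C_nonneg: "0 \<le> C"
  using second_partials_le[of undefined undefined undefined undefined] by linarith

lemma potential_cong: "(\<And>k. k \<in> lball j r \<Longrightarrow> x k = y k) \<Longrightarrow> S j x = S j y"
  using local_potentials unfolding local_potentials_def by presburger

lemma potential_tau: "S j (tau k l x) = S (j + k) x"
  using local_potentials by (simp add: local_potentials_def)

lemma potential_differentiable: "(\<lambda>t. S j (x(i := x i + t))) differentiable (at 0)"
  using local_potentials by (simp add: local_potentials_def C2_fun_def)

lemma pd_differentiable: "(\<lambda>t. pd i (S j) (x(k := x k + t))) differentiable (at 0)"
  using local_potentials by (simp add: local_potentials_def C2_fun_def)

lemma pd_cong:
  assumes "\<And>k. k \<in> lball j r \<Longrightarrow> x k = y k"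
  shows "pd i (S j) x = pd i (S j) y"
proof -
  have "S j (x(i := x i + t)) = S j (y(i := y i + t))" for t
    by (rule potential_cong) (use assms in auto)
  then show ?thesis by (simp add: pd_def)
qed

lemma pd_outside: "i \<notin> lball j r \<Longrightarrow> pd i (S j) x = 0"
proof -
  assume "i \<notin> lball j r"
  then have "S j (x(i := x i + t)) = S j x" for t
    by (intro potential_cong) auto
  then show ?thesis by (simp add: pd_def)
qed

lemma pd_tau: "pd i (S j) (tau k l x) = pd (i + k) (S (j + k)) x"
proof -
  have "(tau k l x)(i := tau k l x i + t) = tau k l (x(i + k := x (i + k) + t))" for t
    by (auto simp: tau_def fun_eq_iff)
  then show ?thesis by (simp add: pd_def potential_tau)
qed

lemma gradW_tau: "gradW r S (tau k l x) i = gradW r S x (i + k)"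
  unfolding gradW_def pd_tau lball_translate by (simp add: sum.reindex)

lemma pd_lipschitz:
  "\<bar>pd i (S j) y - pd i (S j) x\<bar> \<le> C * (\<Sum>k\<in>lball j r. \<bar>y k - x k\<bar>)"
proof -
  have "pd i (S j) (mix (lball j r) x y) = pd i (S j) y"
    by (rule pd_cong) (simp add: mix_def)
  then show ?thesis
    using finite_coordinates_mvt[of "lball j r" "pd i (S j)" x y C]
    by (simp add: pd_differentiable second_partials_le)
qed

lemma gradW_lipschitz:
  "\<bar>gradW r S y i - gradW r S x i\<bar> \<le> C * (\<Sum>j\<in>lball i r. \<Sum>k\<in>lball j r. \<bar>y k - x k\<bar>)"
proof -
  have "\<bar>gradW r S y i - gradW r S x i\<bar> \<le> (\<Sum>j\<in>lball i r. \<bar>pd i (S j) y - pd i (S j) x\<bar>)"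
    unfolding gradW_def sum_subtractf[symmetric] by (rule sum_abs)
  also have "\<dots> \<le> (\<Sum>j\<in>lball i r. C * (\<Sum>k\<in>lball j r. \<bar>y k - x k\<bar>))"
    by (intro sum_mono pd_lipschitz)
  finally show ?thesis by (simp add: sum_distrib_left)
qed

text \<open>Counts the pairs \<open>(j, k)\<close> in the double sum of
  \<open>gradW_lipschitz\<close>, which makes it a Lipschitz constant of \<open>gradW\<close> in the
  sup norm over all sites.\<close>

definition lip :: real where
  "lip = C * (real (card (lball (0::'d site) r)))\<^sup>2"

lemma lip_nonneg: "0 \<le> lip"
  by (simp add: lip_def C_nonneg)

lemma double_ball_sum_le:
  fixes f :: "'d site \<Rightarrow> real"
  assumes "\<And>k. lnorm (k - i) \<le> 2 * r \<Longrightarrow> f k \<le> a"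
  shows "C * (\<Sum>j\<in>lball i r. \<Sum>k\<in>lball j r. f k) \<le> lip * a"
proof -
  have "f k \<le> a" if "j \<in> lball i r" "k \<in> lball j r" for j k
  proof -
    have "lnorm (k - i) \<le> lnorm (k - j) + lnorm (j - i)"
      using lnorm_triangle[of "k - j" "j - i"] by simp
    with that show ?thesis by (intro assms) (simp add: lball_def)
  qed
  then have "(\<Sum>j\<in>lball i r. \<Sum>k\<in>lball j r. f k) \<le> (\<Sum>j\<in>lball i r. \<Sum>k\<in>lball j r. a)"
    by (intro sum_mono)
  also have "\<dots> = (\<Sum>j\<in>lball i r. real (card (lball (0::'d site) r)) * a)"
    by (intro sum.cong refl) (metis card_lball sum_constant)
  also have "\<dots> = (real (card (lball (0::'d site) r)))\<^sup>2 * a"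
    using card_lball[of i r] by (simp add: power2_eq_square)
  finally show ?thesis
    unfolding lip_def by (simp add: C_nonneg mult.assoc mult_left_mono)
qed

lemma gradW_lipschitz_sup:
  assumes "\<And>k. \<bar>y k - x k\<bar> \<le> a"
  shows "\<bar>gradW r S y i - gradW r S x i\<bar> \<le> lip * a"
  using gradW_lipschitz[of y i x] double_ball_sum_le[of i "\<lambda>k. \<bar>y k - x k\<bar>" a] assms by fastforce

text \<open>Coordinates at distance at most \<open>2 * r\<close> from \<open>i\<close> have weight at least
  \<open>2 powr (- 2 * r)\<close> times that of \<open>i\<close>.\<close>

lemma gradW_lipschitz_weighted:
  assumes "\<And>k. Xweight k * \<bar>y k - x k\<bar> \<le> a"
  shows "Xweight i * \<bar>gradW r S y i - gradW r S x i\<bar> \<le> lip * 2 powr (2 * r) * a"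
proof -
  have pos: "0 < Xweight k" for k :: "'d site" by (simp add: Xweight_def)
  have "\<bar>gradW r S y i - gradW r S x i\<bar> \<le> lip * (2 powr (2 * r) / Xweight i * a)"
  proof (rule order_trans[OF gradW_lipschitz double_ball_sum_le])
    fix k assume "lnorm (k - i) \<le> 2 * r"
    then have "- lnorm i \<le> 2 * r - lnorm k"
      using lnorm_triangle[of "k - i" i] by simp
    then have w: "Xweight i \<le> 2 powr (2 * r) * Xweight k"
      unfolding Xweight_def powr_add[symmetric] by (intro powr_mono) auto
    have "Xweight i * \<bar>y k - x k\<bar> \<le> 2 powr (2 * r) * (Xweight k * \<bar>y k - x k\<bar>)"
      using mult_right_mono[OF w, of "\<bar>y k - x k\<bar>"] by (simp add: mult.assoc)
    also have "\<dots> \<le> 2 powr (2 * r) * a"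
      by (intro mult_left_mono assms) auto
    finally show "\<bar>y k - x k\<bar> \<le> 2 powr (2 * r) / Xweight i * a"
      using pos[of i] by (simp add: field_simps)
  qed
  then show ?thesis
    using pos[of i] by (simp add: field_simps)
qed

text \<open>Raise the coordinate \<open>k\<close> first: the twist condition makes the summand of
  \<open>S i\<close> drop strictly. Raising the others cannot undo this, because mixed second
  partials are nonpositive and the coordinate \<open>i\<close> does not move.\<close>

lemma gradW_antimono_strict:
  assumes le: "\<And>k. x k \<le> y k" and i: "x i = y i"
    and k: "lnorm (k - i) = 1" and less: "x k < y k"
  shows "gradW r S y i < gradW r S x i"
proof -
  have D: "pd k (pd i (S j)) z \<le> 0" if "i \<noteq> k" for k j z
    using local_potentials that by (simp add: local_potentials_def)
  have antimono: "pd i (S j) v \<le> pd i (S j) u" if "\<And>k. u k \<le> v k" "u i = v i" for u v j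
  proof -
    have "pd i (S j) (mix (lball j r) u v) \<le> pd i (S j) u"
      proof (rule finite_coordinates_antimono)
      show "pd k (pd i (S j)) z \<le> 0" if "u k \<noteq> v k" for k z
        using D[of k j z] that \<open>u i = v i\<close> by (cases "i = k") auto
    qed (use that in \<open>simp_all add: pd_differentiable del: fun_upd_apply\<close>)
    moreover have "pd i (S j) (mix (lball j r) u v) = pd i (S j) v"
      by (rule pd_cong) (simp add: mix_def)
    ultimately show ?thesis by simp
  qed
  have ki: "k \<noteq> i" using k by auto
  have "pd i (S i) y \<le> pd i (S i) (x(k := y k))"
    by (rule antimono) (use le i ki in auto)
  moreover have "pd i (S i) (x(k := y k)) < pd i (S i) x"
  proof -
    obtain c where c: "pd i (S i) (x(k := y k)) - pd i (S i) x
        = (y k - x k) * pd k (pd i (S i)) (x(k := c))"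
      using coordinate_mvt[of "pd i (S i)" k x "y k"] pd_differentiable less by (metis less_irrefl)
    have "pd k (pd i (S i)) (x(k := c)) < 0"
      using local_potentials k by (simp add: local_potentials_def lnorm_minus_commute)
    with less have "(y k - x k) * pd k (pd i (S i)) (x(k := c)) < 0"
      by (simp add: mult_pos_neg)
    with c show ?thesis by linarith
  qed
  ultimately have "pd i (S i) y < pd i (S i) x" by linarith
  then show ?thesis
    unfolding gradW_def
    by (intro sum_strict_mono_ex1 ballI antimono le i bexI[of _ i])
      (use r_pos in \<open>auto intro: center_in_lball\<close>)
qed

lemma gradW_eq_imp_eq:
  assumes le: "\<And>k. x k \<le> y k"
    and eq: "\<And>i. x i = y i \<Longrightarrow> gradW r S x i = gradW r S y i"
    and "x i0 = y i0"
  shows "x = y"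
proof -
  have "{i. x i = y i} = UNIV"
  proof (rule neighbour_closed_eq_UNIV)
    fix i k assume "i \<in> {i. x i = y i}" "lnorm (k - i) = 1"
    then show "k \<in> {i. x i = y i}"
      using gradW_antimono_strict[of x y i k] le eq[of i] by (force simp: less_le)
  next
    show "i0 \<in> {i. x i = y i}" using assms(3) by simp
  qed
  then show ?thesis by auto
qed

section \<open>Pointwise limits and integer shifts\<close>

lemma tendsto_gradW:
  assumes "\<And>i. (\<lambda>n. x n i) \<longlonglongrightarrow> y i"
  shows "(\<lambda>n. gradW r S (x n) i) \<longlonglongrightarrow> gradW r S y i"
proof (rule LIM_zero_cancel, rule Lim_null_comparison)
  show "\<forall>\<^sub>F n in sequentially. norm (gradW r S (x n) i - gradW r S y i)
      \<le> C * (\<Sum>j\<in>lball i r. \<Sum>k\<in>lball j r. \<bar>x n k - y k\<bar>)"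
    using gradW_lipschitz by simp
  show "(\<lambda>n. C * (\<Sum>j\<in>lball i r. \<Sum>k\<in>lball j r. \<bar>x n k - y k\<bar>)) \<longlonglongrightarrow> 0"
    by (intro tendsto_mult_right_zero tendsto_null_sum tendsto_rabs_zero LIM_zero assms)
qed

lemma tendsto_potential:
  assumes lim: "\<And>i. (\<lambda>n. x n i) \<longlonglongrightarrow> y i"
  shows "(\<lambda>n. S j (x n)) \<longlonglongrightarrow> S j y"
proof (rule LIM_zero_cancel, rule Lim_null_comparison)
  \<comment> \<open>Bounds the first partials in the box of radius 1 around \<open>y\<close>: their
    values at \<open>y\<close> plus the variation allowed by \<open>pd_lipschitz\<close>.\<close>
  define A where "A = (\<Sum>k\<in>lball j r. \<bar>pd k (S j) y\<bar>) + C * (\<Sum>k\<in>lball j r. 1)"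
  have "\<forall>\<^sub>F n in sequentially. \<forall>k\<in>lball j r. \<bar>x n k - y k\<bar> < 1"
  proof (intro eventually_ball_finite ballI)
    fix k
    show "\<forall>\<^sub>F n in sequentially. \<bar>x n k - y k\<bar> < 1"
      using tendstoD[OF lim[of k], of 1] by (simp add: dist_real_def)
  qed simp
  then show "\<forall>\<^sub>F n in sequentially. norm (S j (x n) - S j y)
      \<le> A * (\<Sum>k\<in>lball j r. \<bar>x n k - y k\<bar>)"
  proof eventually_elim
    case (elim n)
    have "\<bar>S j (mix (lball j r) y (x n)) - S j y\<bar> \<le> A * (\<Sum>k\<in>lball j r. \<bar>x n k - y k\<bar>)"
    proof (rule finite_coordinates_mvt)
      fix k z assume k: "k \<in> lball j r" and z: "\<And>i. z i \<in> closed_segment (y i) (x n i)"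
      have "\<bar>z i - y i\<bar> \<le> 1" if "i \<in> lball j r" for i
        using z[of i] elim that by (auto simp: closed_segment_eq_real_ivl split: if_splits)
      then have "(\<Sum>k\<in>lball j r. \<bar>z k - y k\<bar>) \<le> (\<Sum>k\<in>lball j r. 1)"
        by (intro sum_mono) auto
      then have "C * (\<Sum>k\<in>lball j r. \<bar>z k - y k\<bar>) \<le> C * (\<Sum>k\<in>lball j r. 1)"
        by (rule mult_left_mono[OF _ C_nonneg])
      moreover have "\<bar>pd k (S j) y\<bar> \<le> (\<Sum>k\<in>lball j r. \<bar>pd k (S j) y\<bar>)"
        using k by (intro member_le_sum) auto
      ultimately show "\<bar>pd k (S j) z\<bar> \<le> A"
        using pd_lipschitz[of k j z y] unfolding A_def by linarith
    qed (simp_all add: potential_differentiable del: fun_upd_apply)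
    moreover have "S j (mix (lball j r) y (x n)) = S j (x n)"
      by (rule potential_cong) (simp add: mix_def)
    ultimately show ?case by simp
  qed
  show "(\<lambda>n. A * (\<Sum>k\<in>lball j r. \<bar>x n k - y k\<bar>)) \<longlonglongrightarrow> 0"
    by (intro tendsto_mult_right_zero tendsto_null_sum tendsto_rabs_zero LIM_zero lim)
qed

lemma global_minimizer_tau:
  assumes "global_minimizer r S x"
  shows "global_minimizer r S (tau 0 l x)"
proof -
  have "W_B S B (tau 0 l x) = W_B S B x"
    "W_B S B (\<lambda>i. tau 0 l x i + y i) = W_B S B (\<lambda>i. x i + y i)" for B y
  proof -
    have "(\<lambda>i. tau 0 l x i + y i) = tau 0 l (\<lambda>i. x i + y i)"
      by (auto simp: tau_def)
    then show "W_B S B (tau 0 l x) = W_B S B x"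
      "W_B S B (\<lambda>i. tau 0 l x i + y i) = W_B S B (\<lambda>i. x i + y i)"
      by (simp_all add: W_B_def potential_tau)
  qed
  with assms show ?thesis by (simp add: global_minimizer_def)
qed

end

lemma obtain_potentials:
  assumes "local_potentials r S"
  obtains C where "potentials r S C"
  proof -
  from assms obtain C where "\<forall>i k j x. \<bar>pd k (pd i (S j)) x\<bar> \<le> C"
    unfolding local_potentials_def by presburger
  with assms show ?thesis by (intro that[of C] potentials.intro) simp_all
qed

subsection \<open>The weighted configuration space\<close>

lemma Xweight_pos: "0 < Xweight i"
  by (simp add: Xweight_def)

text \<open>The factorisation over coordinates turns sums over boxes of sites into products of
  one-dimensional geometric sums.\<close>

lemma Xweight_eq_prod: "Xweight i powr a = (\<Prod>k\<in>UNIV. 2 powr (- a * \<bar>i $ k\<bar>))"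
  by (simp add: Xweight_def lnorm_def powr_powr powr_sum[symmetric] sum_negf sum_distrib_left mult.commute)

lemma sum_geometric_int_le:
  fixes a :: real
  assumes "0 < a" and "finite A"
  shows "(\<Sum>m\<in>A. 2 powr (- a * \<bar>m :: int\<bar>)) \<le> 2 / (1 - 2 powr (- a))"
proof -
  define q where "q = 2 powr (- a)"
  have q: "0 < q" "q < 1" using assms(1) powr_less_mono[of "- a" 0 2] by (auto simp: q_def)
  have pow: "2 powr (- a * \<bar>m\<bar>) = q ^ nat \<bar>m\<bar>" for m :: int
  proof -
    have "q ^ nat \<bar>m\<bar> = q powr real (nat \<bar>m\<bar>)"
      by (rule powr_realpow[OF q(1), symmetric])
    also have "\<dots> = 2 powr (- a * \<bar>m\<bar>)"
      by (simp add: q_def powr_powr)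
    finally show ?thesis by simp
  qed
  have half: "(\<Sum>m\<in>B. q ^ nat \<bar>m\<bar>) \<le> 1 / (1 - q)"
    if "finite B" "inj_on (\<lambda>m. nat \<bar>m\<bar>) B" for B :: "int set"
  proof -
    have "(\<Sum>m\<in>B. q ^ nat \<bar>m\<bar>) = (\<Sum>n\<in>(\<lambda>m. nat \<bar>m\<bar>) ` B. q ^ n)"
      using that by (simp add: sum.reindex)
    also have "\<dots> \<le> (\<Sum>n. q ^ n)"
      using q that by (intro sum_le_suminf summable_geometric) auto
    finally show ?thesis using q by (simp add: suminf_geometric)
  qed
  \<comment> \<open>On each half line the absolute value is injective, so each half costs at most
    one geometric series.\<close>
  have "(\<Sum>m\<in>A. q ^ nat \<bar>m\<bar>) = (\<Sum>m\<in>A \<inter> {0..}. q ^ nat \<bar>m\<bar>) + (\<Sum>m\<in>A \<inter> {..<0}. q ^ nat \<bar>m\<bar>)"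
    using assms(2) by (subst sum.union_disjoint[symmetric]) (auto intro!: sum.cong)
  also have "\<dots> \<le> 1 / (1 - q) + 1 / (1 - q)"
    using assms(2) by (intro add_mono half) (auto simp: inj_on_def)
  finally show ?thesis unfolding pow q_def[symmetric] by simp
qed

text \<open>A finite set of sites is enlarged to a box, where the sum of products is a product of
  sums. Exponent 1 gives the weights themselves; exponent 1/2 serves
  \<open>Xspace_linear_growth\<close>.\<close>

lemma Xweight_powr_summable:
  assumes "0 < a"
  shows "(\<lambda>i :: 'd::finite site. Xweight i powr a) summable_on UNIV"
proof (rule nonneg_bdd_above_summable_on)
  let ?b = "2 / (1 - 2 powr (- a))"
  show "bdd_above (sum (\<lambda>i :: 'd site. Xweight i powr a) ` {F. F \<subseteq> UNIV \<and> finite F})"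
  proof (rule bdd_aboveI2)
    fix F :: "'d site set" assume "F \<in> {F. F \<subseteq> UNIV \<and> finite F}"
    then have F: "finite F" by simp
    define A where "A = (\<lambda>(i, k). i $ k) ` (F \<times> (UNIV :: 'd set))"
    have A: "finite A" using F by (simp add: A_def)
    have "(\<Sum>i\<in>F. Xweight i powr a) = (\<Sum>g\<in>vec_nth ` F. \<Prod>k\<in>UNIV. 2 powr (- a * \<bar>g k\<bar>))"
      by (subst sum.reindex) (auto simp: inj_on_def vec_nth_inject Xweight_eq_prod)
    also have "\<dots> \<le> (\<Sum>g\<in>(UNIV :: 'd set) \<rightarrow>\<^sub>E A. \<Prod>k\<in>UNIV. 2 powr (- a * \<bar>g k\<bar>))"
    proof (rule sum_mono2)
      show "finite ((UNIV :: 'd set) \<rightarrow>\<^sub>E A)" using A by (intro finite_PiE) auto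
      show "vec_nth ` F \<subseteq> UNIV \<rightarrow>\<^sub>E A" by (force simp: A_def)
    qed (simp add: prod_nonneg)
    also have "\<dots> = (\<Prod>k\<in>(UNIV :: 'd set). \<Sum>m\<in>A. 2 powr (- a * \<bar>m\<bar>))"
      using A by (subst prod_sum_PiE) auto
    also have "\<dots> \<le> (\<Prod>k\<in>(UNIV :: 'd set). ?b)"
      by (intro prod_mono conjI sum_nonneg sum_geometric_int_le A assms) auto
    finally show "(\<Sum>i\<in>F. Xweight i powr a) \<le> (\<Prod>k\<in>(UNIV :: 'd set). ?b)" .
  qed
qed simp

lemma summable_Xweight: "(\<lambda>i :: 'd::finite site. Xweight i) summable_on UNIV"
  using Xweight_powr_summable[of 1] by (simp add: Xweight_pos less_imp_le abs_of_pos)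

lemma Xspace_dominated:
  assumes "y \<in> Xspace" and "\<And>i. \<bar>x i\<bar> \<le> \<bar>y i\<bar>"
  shows "x \<in> Xspace"
  using assms unfolding Xspace_def mem_Collect_eq
  by (elim summable_on_comparison_test) (auto intro!: mult_left_mono simp: Xweight_pos less_imp_le)

lemma Xspace_add: "x \<in> Xspace \<Longrightarrow> y \<in> Xspace \<Longrightarrow> (\<lambda>i. x i + y i) \<in> Xspace"
  unfolding Xspace_def mem_Collect_eq
proof (rule summable_on_comparison_test[OF summable_on_add])
  fix i
  have "Xweight i * \<bar>x i + y i\<bar> \<le> Xweight i * (\<bar>x i\<bar> + \<bar>y i\<bar>)"
    by (intro mult_left_mono abs_triangle_ineq) (simp add: Xweight_pos less_imp_le)
  then show "Xweight i * \<bar>x i + y i\<bar> \<le> Xweight i * \<bar>x i\<bar> + Xweight i * \<bar>y i\<bar>"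
    by (simp add: distrib_left)
qed (simp_all add: Xweight_pos less_imp_le)

lemma Xspace_scale: "x \<in> Xspace \<Longrightarrow> (\<lambda>i. c * x i) \<in> Xspace"
  unfolding Xspace_def mem_Collect_eq
  using summable_on_cmult_right[of "\<lambda>i. Xweight i * \<bar>x i\<bar>" UNIV "\<bar>c\<bar>"]
  by (simp add: abs_mult mult.left_commute)

lemma Xspace_const: "(\<lambda>i. c) \<in> Xspace"
  unfolding Xspace_def mem_Collect_eq
  using summable_on_cmult_left[OF summable_Xweight] by blast

lemma Xspace_abs: "x \<in> Xspace \<Longrightarrow> (\<lambda>i. \<bar>x i\<bar>) \<in> Xspace"
  by (simp add: Xspace_def)

lemma Xspace_sum:
  assumes "\<And>k. k \<in> A \<Longrightarrow> x k \<in> Xspace"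
  shows "(\<lambda>i. \<Sum>k\<in>A. x k i) \<in> Xspace"
  using assms
proof (induction A rule: infinite_finite_induct)
  case (insert k A)
  then show ?case using Xspace_add[of "x k" "\<lambda>i. \<Sum>k\<in>A. x k i"] by simp
qed (use Xspace_const[of 0] in simp_all)

lemma Xweight_translate: "Xweight i \<le> 2 powr lnorm k * Xweight (i + k)"
proof -
  have "lnorm (i + k) \<le> lnorm i + lnorm k" by (rule lnorm_triangle)
  then show ?thesis
    unfolding Xweight_def powr_add[symmetric] by (intro powr_mono) auto
qed

lemma Xspace_translate:
  assumes "x \<in> Xspace"
  shows "(\<lambda>i. x (i + k)) \<in> Xspace"
proof -
  have bij: "bij (\<lambda>i. i + k)"
    by (rule bij_betw_byWitness[where f' = "\<lambda>i. i - k"]) auto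
  have "(\<lambda>i. Xweight (i + k) * \<bar>x (i + k)\<bar>) summable_on UNIV"
    using assms summable_on_reindex_bij_betw[OF bij, of "\<lambda>i. Xweight i * \<bar>x i\<bar>"]
    by (simp add: Xspace_def)
  then have "(\<lambda>i. 2 powr lnorm k * (Xweight (i + k) * \<bar>x (i + k)\<bar>)) summable_on UNIV"
    by (rule summable_on_cmult_right)
  then show ?thesis
    unfolding Xspace_def mem_Collect_eq
  proof (rule summable_on_comparison_test)
    fix i
    show "Xweight i * \<bar>x (i + k)\<bar> \<le> 2 powr lnorm k * (Xweight (i + k) * \<bar>x (i + k)\<bar>)"
      using mult_right_mono[OF Xweight_translate[of i k], of "\<bar>x (i + k)\<bar>"] by (simp add: mult.assoc)
  qed (simp add: Xweight_pos less_imp_le)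
qed

text \<open>Half of the exponential decay of the weight pays for the linear growth. The constant 4
  in \<open>t \<le> 4 * 2 powr (t / 2)\<close> comes from \<open>ln 2 \<ge> 1 / 2\<close>.\<close>

lemma Xspace_linear_growth:
  fixes x :: "'d::finite config" and a b :: real
  assumes "\<And>i. \<bar>x i\<bar> \<le> a + b * lnorm i"
  shows "x \<in> Xspace"
proof -
  have lin: "t \<le> 4 * 2 powr (t / 2)" if "0 \<le> t" for t :: real
  proof -
    have "t / 2 * ln 2 \<le> exp (t / 2 * ln 2) - 1"
      using exp_ge_add_one_self[of "t / 2 * ln 2"] by linarith
    moreover have "t / 4 \<le> t / 2 * ln 2"
    proof -
      have "1 / 2 \<le> ln (2::real)" using ln2_ge_two_thirds by simp
      then have "t / 2 * (1 / 2) \<le> t / 2 * ln 2" using that by (intro mult_left_mono) auto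
      then show ?thesis by simp
    qed
    ultimately show ?thesis by (simp add: powr_def mult.commute)
  qed
  have "(\<lambda>i :: 'd site. real_of_int (lnorm i)) \<in> Xspace"
    unfolding Xspace_def mem_Collect_eq
  proof (rule summable_on_comparison_test)
    show "(\<lambda>i :: 'd site. 4 * Xweight i powr (1/2)) summable_on UNIV"
      by (intro summable_on_cmult_right Xweight_powr_summable) simp
    fix i :: "'d site"
    have "Xweight i * \<bar>real_of_int (lnorm i)\<bar> \<le> Xweight i * (4 * 2 powr (lnorm i / 2))"
      using lin[of "lnorm i"] by (intro mult_left_mono) (auto simp: Xweight_pos less_imp_le)
    also have "\<dots> = 4 * Xweight i powr (1/2)"
      by (simp add: Xweight_def powr_powr flip: powr_add)
    finally show "Xweight i * \<bar>real_of_int (lnorm i)\<bar> \<le> 4 * Xweight i powr (1/2)" .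
  qed (simp add: Xweight_pos less_imp_le)
  then have "(\<lambda>i :: 'd site. a + b * lnorm i) \<in> Xspace"
    by (intro Xspace_add[OF Xspace_const Xspace_scale])
  then show ?thesis
  proof (rule Xspace_dominated)
    fix i show "\<bar>x i\<bar> \<le> \<bar>a + b * lnorm i\<bar>" using assms[of i] by linarith
  qed
qed

lemma coordinate_le_Xnorm:
  assumes "x \<in> Xspace"
  shows "Xweight i * \<bar>x i\<bar> \<le> Xnorm x"
proof -
  have "infsum (\<lambda>i. Xweight i * \<bar>x i\<bar>) {i} \<le> infsum (\<lambda>i. Xweight i * \<bar>x i\<bar>) UNIV"
    using assms by (intro infsum_mono_neutral) (auto simp: Xspace_def Xweight_pos less_imp_le)
  then show ?thesis by (simp add: Xnorm_def)
qed

lemma Xnorm_nonneg: "0 \<le> Xnorm x"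
  unfolding Xnorm_def by (intro infsum_nonneg) (simp add: Xweight_pos less_imp_le)

text \<open>The factor is the sum of all weights. Estimates uniform over the sites thereby become
  estimates in the norm of X.\<close>

lemma Xnorm_le_sup:
  fixes x :: "'d::finite config"
  assumes "\<And>i. \<bar>x i\<bar> \<le> a"
  shows "Xnorm x \<le> a * Xnorm (\<lambda>i :: 'd site. 1)"
proof -
  have a: "0 \<le> a" using assms[of undefined] by linarith
  have "x \<in> Xspace"
    by (rule Xspace_dominated[OF Xspace_const[of a]]) (use assms a in auto)
  then have "Xnorm x \<le> (\<Sum>\<^sub>\<infinity>i :: 'd site. a * Xweight i)"
    unfolding Xnorm_def Xspace_def mem_Collect_eq
    by (rule infsum_mono[OF _ summable_on_cmult_right[OF summable_Xweight]])
      (metis assms mult.commute mult_left_mono Xweight_pos less_imp_le)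
  then show ?thesis
    by (simp add: Xnorm_def infsum_cmult_right')
qed

subsection \<open>The gradient flow\<close>

context potentials
begin

lemma gradW_in_Xspace:
  assumes "x \<in> Xspace"
  shows "gradW r S x \<in> Xspace"
proof -
  define D where "D i = C * (\<Sum>j\<in>lball i r. \<Sum>k\<in>lball j r. \<bar>x k\<bar>)" for i
  have "D = (\<lambda>i. C * (\<Sum>j\<in>lball 0 r. \<Sum>k\<in>lball 0 r. \<bar>x (i + (k + j))\<bar>))"
  proof
    fix i
    have *: "lball i r = (\<lambda>k. k + i) ` lball 0 r" for i :: "'d site"
      using lball_translate[of 0 i r] by simp
    have "(\<Sum>k\<in>lball (j + i) r. \<bar>x k\<bar>) = (\<Sum>k\<in>lball 0 r. \<bar>x (i + (k + j))\<bar>)" for j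
      by (subst *) (simp add: sum.reindex ac_simps)
    then show "D i = C * (\<Sum>j\<in>lball 0 r. \<Sum>k\<in>lball 0 r. \<bar>x (i + (k + j))\<bar>)"
      unfolding D_def by (simp add: *[of i] sum.reindex)
  qed
  moreover have "(\<lambda>i. C * (\<Sum>j\<in>lball 0 r. \<Sum>k\<in>lball 0 r. \<bar>x (i + (k + j))\<bar>)) \<in> Xspace"
    by (rule Xspace_scale, rule Xspace_sum, rule Xspace_sum, rule Xspace_abs, rule Xspace_translate[OF assms])
  ultimately have "D \<in> Xspace" by simp
  then have "(\<lambda>i. \<bar>gradW r S (\<lambda>_. 0) 0\<bar> + D i) \<in> Xspace"
    by (intro Xspace_add Xspace_const)
  then show ?thesis
  proof (rule Xspace_dominated)
    fix i
    \<comment> \<open>The zero configuration is shift-invariant.\<close>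
    have "gradW r S (\<lambda>_. 0) i = gradW r S (\<lambda>_. 0) 0"
      using gradW_tau[of i 0 "\<lambda>_. 0" 0] by (simp add: tau_def)
    then show "\<bar>gradW r S x i\<bar> \<le> \<bar>\<bar>gradW r S (\<lambda>_. 0) 0\<bar> + D i\<bar>"
      using gradW_lipschitz[of x i "\<lambda>_. 0"] by (simp add: D_def)
  qed
qed

text \<open>For a configuration outside \<open>Xspace\<close> the sum in \<open>Xnorm\<close> takes
  the default value 0. Membership is what lets the limit in \<open>flow_solution\<close> control
  single coordinates.\<close>

lemma flow_solution_remainder_in_Xspace:
  assumes "flow_solution r S x \<gamma>"
  shows "(\<lambda>i. \<gamma> s i - \<gamma> t i + (s - t) * gradW r S (\<gamma> t) i) \<in> Xspace"
proof -
  have g: "\<gamma> t \<in> Xspace" for t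
    using assms by (simp add: flow_solution_def)
  have "(\<lambda>i. \<gamma> s i + (-1) * \<gamma> t i + (s - t) * gradW r S (\<gamma> t) i) \<in> Xspace"
    by (intro Xspace_add Xspace_scale gradW_in_Xspace g)
  then show ?thesis by simp
qed

lemma flow_solution_has_derivative:
  assumes "flow_solution r S x \<gamma>"
  shows "((\<lambda>t. \<gamma> t i) has_real_derivative - gradW r S (\<gamma> t) i) (at t)"
proof -
  let ?R = "\<lambda>s i. \<gamma> s i - \<gamma> t i + (s - t) * gradW r S (\<gamma> t) i"
  have "((\<lambda>s. Xnorm (?R s) / \<bar>s - t\<bar>) \<longlongrightarrow> 0) (at t)"
    using assms by (simp add: flow_solution_def)
  then have "((\<lambda>s. Xnorm (?R s) / \<bar>s - t\<bar> / Xweight i) \<longlongrightarrow> 0) (at t)"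
    by (rule tendsto_divide_zero)
  then have "((\<lambda>s. ?R s i / (s - t)) \<longlongrightarrow> 0) (at t)"
  proof (rule Lim_null_comparison[rotated], intro always_eventually allI)
    fix s
    have "\<bar>?R s i\<bar> \<le> Xnorm (?R s) / Xweight i"
      using coordinate_le_Xnorm[OF flow_solution_remainder_in_Xspace[OF assms], of i s t] Xweight_pos[of i]
      by (simp add: field_simps)
    then have "\<bar>?R s i\<bar> / \<bar>s - t\<bar> \<le> Xnorm (?R s) / Xweight i / \<bar>s - t\<bar>"
      by (rule divide_right_mono) simp
    then show "norm (?R s i / (s - t)) \<le> Xnorm (?R s) / \<bar>s - t\<bar> / Xweight i"
      by (simp add: abs_divide mult.commute)
  qed
  then have "((\<lambda>s. ?R s i / (s - t) - gradW r S (\<gamma> t) i) \<longlongrightarrow> 0 - gradW r S (\<gamma> t) i) (at t)"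
    by (intro tendsto_diff tendsto_const)
  then have "((\<lambda>s. (\<gamma> s i - \<gamma> t i) / (s - t)) \<longlongrightarrow> - gradW r S (\<gamma> t) i) (at t)"
    unfolding diff_0
  proof (rule Lim_transform_eventually)
    show "\<forall>\<^sub>F s in at t. ?R s i / (s - t) - gradW r S (\<gamma> t) i = (\<gamma> s i - \<gamma> t i) / (s - t)"
      by (auto simp: eventually_at_filter field_simps)
  qed
  then show ?thesis
    by (simp add: has_field_derivative_iff)
qed

text \<open>Gives the bound, uniform over the sites, that starts the iteration in
  \<open>flow_solution_locally_unique\<close>. The weight is essential: an arbitrary trajectory in X
  may have displacements unbounded over the sites.\<close>

lemma flow_solution_locally_lipschitz:
  assumes "flow_solution r S x \<gamma>"
  obtains d B where "0 < d"
    "\<And>s i. \<bar>s - t\<bar> \<le> d \<Longrightarrow> Xweight i * \<bar>\<gamma> s i - \<gamma> t i\<bar> \<le> B"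
proof -
  let ?R = "\<lambda>s i. \<gamma> s i - \<gamma> t i + (s - t) * gradW r S (\<gamma> t) i"
  have "\<forall>\<^sub>F s in at t. Xnorm (?R s) / \<bar>s - t\<bar> < 1"
    using assms by (intro order_tendstoD(2)[where y = 0]) (auto simp: flow_solution_def)
  then obtain e where e: "0 < e" "\<And>s. s \<noteq> t \<Longrightarrow> \<bar>s - t\<bar> < e \<Longrightarrow> Xnorm (?R s) / \<bar>s - t\<bar> < 1"
    unfolding eventually_at by (auto simp: dist_real_def)
  show ?thesis
  proof (rule that[of "e / 2" "e / 2 * (1 + Xnorm (gradW r S (\<gamma> t)))"])
    fix s i assume s: "\<bar>s - t\<bar> \<le> e / 2"
    have "\<gamma> t \<in> Xspace" using assms by (simp add: flow_solution_def)
    then have g: "Xweight i * \<bar>gradW r S (\<gamma> t) i\<bar> \<le> Xnorm (gradW r S (\<gamma> t))"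
      by (intro coordinate_le_Xnorm gradW_in_Xspace)
    have "Xweight i * \<bar>\<gamma> s i - \<gamma> t i\<bar> \<le> \<bar>s - t\<bar> * (1 + Xnorm (gradW r S (\<gamma> t)))"
    proof (cases "s = t")
      case False
      with e(2)[of s] s e(1) have R: "Xnorm (?R s) \<le> \<bar>s - t\<bar>" by (simp add: divide_less_eq)
      have "\<bar>\<gamma> s i - \<gamma> t i\<bar> \<le> \<bar>?R s i\<bar> + \<bar>s - t\<bar> * \<bar>gradW r S (\<gamma> t) i\<bar>"
        unfolding abs_mult[symmetric] by linarith
      then have "Xweight i * \<bar>\<gamma> s i - \<gamma> t i\<bar>
          \<le> Xweight i * (\<bar>?R s i\<bar> + \<bar>s - t\<bar> * \<bar>gradW r S (\<gamma> t) i\<bar>)"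
        by (rule mult_left_mono) (simp add: Xweight_pos less_imp_le)
      also have "\<dots> = Xweight i * \<bar>?R s i\<bar> + \<bar>s - t\<bar> * (Xweight i * \<bar>gradW r S (\<gamma> t) i\<bar>)"
        by (simp add: algebra_simps)
      also have "\<dots> \<le> \<bar>s - t\<bar> + \<bar>s - t\<bar> * Xnorm (gradW r S (\<gamma> t))"
        using coordinate_le_Xnorm[OF flow_solution_remainder_in_Xspace[OF assms], of i s t] R g
        by (intro add_mono mult_left_mono) auto
      finally show ?thesis by (simp add: algebra_simps)
    qed simp
    also have "\<dots> \<le> e / 2 * (1 + Xnorm (gradW r S (\<gamma> t)))"
      using s Xnorm_nonneg[of "gradW r S (\<gamma> t)"] by (intro mult_right_mono) auto
    finally show "Xweight i * \<bar>\<gamma> s i - \<gamma> t i\<bar> \<le> e / 2 * (1 + Xnorm (gradW r S (\<gamma> t)))" .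
  qed (use e(1) in simp)
qed

text \<open>On a short interval around a time where two solutions agree, the weighted sup norm of their
  difference is at most half of itself, by the mean value theorem in each coordinate.\<close>

lemma flow_solution_locally_unique:
  assumes \<gamma>: "flow_solution r S x \<gamma>" and \<eta>: "flow_solution r S y \<eta>" and eq: "\<gamma> t = \<eta> t"
  obtains d where "0 < d" "\<And>s. \<bar>s - t\<bar> \<le> d \<Longrightarrow> \<gamma> s = \<eta> s"
proof -
  obtain d1 B1 where 1: "0 < d1"
    "\<And>s i. \<bar>s - t\<bar> \<le> d1 \<Longrightarrow> Xweight i * \<bar>\<gamma> s i - \<gamma> t i\<bar> \<le> B1"
    using flow_solution_locally_lipschitz[OF \<gamma>] by metis
  obtain d2 B2 where 2: "0 < d2"
    "\<And>s i. \<bar>s - t\<bar> \<le> d2 \<Longrightarrow> Xweight i * \<bar>\<eta> s i - \<eta> t i\<bar> \<le> B2"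
    using flow_solution_locally_lipschitz[OF \<eta>] by metis
  define L where "L = lip * 2 powr (2 * r)"
  have L: "0 \<le> L" by (simp add: L_def lip_nonneg)
  \<comment> \<open>The last entry ensures \<open>d * L \<le> 1 / 2\<close>, the contraction factor;
    the summand 1 keeps the quotient meaningful if \<open>L = 0\<close>.\<close>
  define d where "d = min (min d1 d2) (1 / (2 * L + 1))"
  have d: "0 < d" "d \<le> d1" "d \<le> d2" using 1(1) 2(1) L by (auto simp: d_def)
  have "d * (2 * L + 1) \<le> 1 / (2 * L + 1) * (2 * L + 1)"
    using L by (intro mult_right_mono) (auto simp: d_def)
  then have dL: "d * L \<le> 1 / 2" using L d(1) by (simp add: algebra_simps)
  have B: "0 \<le> B1 + B2"
    using 1(1) 1(2)[of t undefined] 2(1) 2(2)[of t undefined] by simp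
  have bound: "\<bar>s - t\<bar> \<le> d \<Longrightarrow> Xweight i * \<bar>\<gamma> s i - \<eta> s i\<bar> \<le> (B1 + B2) / 2 ^ p" for p s i
  proof (induction p arbitrary: s i)
    case 0
    have "\<bar>\<gamma> s i - \<eta> s i\<bar> \<le> \<bar>\<gamma> s i - \<gamma> t i\<bar> + \<bar>\<eta> s i - \<eta> t i\<bar>"
      using fun_cong[OF eq, of i] by linarith
    then have "Xweight i * \<bar>\<gamma> s i - \<eta> s i\<bar> \<le> Xweight i * (\<bar>\<gamma> s i - \<gamma> t i\<bar> + \<bar>\<eta> s i - \<eta> t i\<bar>)"
      by (rule mult_left_mono) (simp add: Xweight_pos less_imp_le)
    also have "\<dots> \<le> B1 + B2"
      unfolding distrib_left using 0 d by (intro add_mono 1(2) 2(2)) auto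
    finally show ?case by simp
  next
    case (Suc p)
    let ?b = "(B1 + B2) / 2 ^ p"
    have b: "0 \<le> ?b" using B by simp
    have "\<bar>(\<gamma> s i - \<eta> s i) - (\<gamma> t i - \<eta> t i)\<bar> \<le> (L * ?b / Xweight i) * \<bar>s - t\<bar>"
    proof (rule field_differentiable_bound[of "closed_segment t s", unfolded real_norm_def])
      show "((\<lambda>s. \<gamma> s i - \<eta> s i) has_field_derivative - gradW r S (\<gamma> u) i - - gradW r S (\<eta> u) i)
          (at u within closed_segment t s)" for u
        by (rule DERIV_diff; rule has_field_derivative_at_within)
          (rule flow_solution_has_derivative[OF \<gamma>] flow_solution_has_derivative[OF \<eta>])+
      fix u assume "u \<in> closed_segment t s"
      then have "\<bar>u - t\<bar> \<le> d" using Suc.prems by (auto simp: closed_segment_eq_real_ivl split: if_splits)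
      then have "Xweight i * \<bar>gradW r S (\<gamma> u) i - gradW r S (\<eta> u) i\<bar> \<le> lip * 2 powr (2 * r) * ?b"
        by (intro gradW_lipschitz_weighted Suc.IH)
      then show "\<bar>- gradW r S (\<gamma> u) i - - gradW r S (\<eta> u) i\<bar> \<le> L * ?b / Xweight i"
        using Xweight_pos[of i] unfolding L_def by (simp add: field_simps abs_minus_commute)
    qed auto
    also have "\<dots> \<le> (L * ?b / Xweight i) * d"
      using Suc.prems L b B Xweight_pos[of i]
      by (intro mult_left_mono divide_nonneg_pos mult_nonneg_nonneg) auto
    finally have "Xweight i * \<bar>\<gamma> s i - \<eta> s i\<bar> \<le> d * L * ?b"
      using eq Xweight_pos[of i] by (simp add: field_simps)
    also have "\<dots> \<le> 1 / 2 * ?b"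
      by (rule mult_right_mono[OF dL b])
    finally show ?case by simp
  qed
  show ?thesis
  proof (rule that[OF d(1)], rule ext)
    fix s i assume s: "\<bar>s - t\<bar> \<le> d"
    have "(\<lambda>p. (B1 + B2) / 2 ^ p) \<longlonglongrightarrow> 0" by (rule LIMSEQ_divide_realpow_zero) simp
    then have "Xweight i * \<bar>\<gamma> s i - \<eta> s i\<bar> \<le> 0"
      by (rule LIMSEQ_le_const) (use bound[OF s] in blast)
    then show "\<gamma> s i = \<eta> s i"
      using Xweight_pos[of i] by (simp add: mult_le_0_iff)
  qed
qed

lemma flow_solution_continuous:
  assumes "flow_solution r S x \<gamma>"
  shows "continuous_on A (\<lambda>t. \<gamma> t i)"
  using flow_solution_has_derivative[OF assms]
  by (meson DERIV_isCont continuous_at_imp_continuous_on)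

lemma flow_solution_unique:
  assumes \<gamma>: "flow_solution r S x \<gamma>" and \<eta>: "flow_solution r S y \<eta>" and eq: "\<gamma> t0 = \<eta> t0"
  shows "\<gamma> = \<eta>"
proof -
  let ?T = "{t. \<gamma> t = \<eta> t}"
  have "open ?T"
  proof (clarsimp simp: open_dist dist_real_def)
    fix t assume "\<gamma> t = \<eta> t"
    then obtain d where "0 < d" "\<And>s. \<bar>s - t\<bar> \<le> d \<Longrightarrow> \<gamma> s = \<eta> s"
      using flow_solution_locally_unique[OF \<gamma> \<eta>] by metis
    then show "\<exists>e>0. \<forall>s. \<bar>s - t\<bar> < e \<longrightarrow> \<gamma> s = \<eta> s" by (meson less_imp_le)
  qed
  moreover have "closed ?T"
  proof -
    have "?T = (\<Inter>i. {t. \<gamma> t i = \<eta> t i})" by (auto simp: fun_eq_iff)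
    then show ?thesis
      by (auto intro!: closed_Collect_eq flow_solution_continuous \<gamma> \<eta>)
  qed
  ultimately have "?T = UNIV"
    using eq clopen[of ?T] by auto
  then show ?thesis by auto
qed

end

subsection \<open>Ghost circles\<close>

locale circle = potentials r S C
  for r :: real and S :: "'d::finite site \<Rightarrow> 'd config \<Rightarrow> real" and C :: real +
  fixes \<Gamma> :: "'d config set"
  assumes ghost_circle: "ghost_circle r S \<Gamma>"
begin

lemma comparable: "x \<in> \<Gamma> \<Longrightarrow> y \<in> \<Gamma> \<Longrightarrow> x \<lless> y \<or> x = y \<or> y \<lless> x"
  using ghost_circle by (simp add: ghost_circle_def)

lemma tau_in: "x \<in> \<Gamma> \<Longrightarrow> tau k l x \<in> \<Gamma>"
  using ghost_circle by (simp add: ghost_circle_def)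

lemma le_of_coordinate:
  assumes "x \<in> \<Gamma>" "y \<in> \<Gamma>" "x i \<le> y i"
  shows "x k \<le> y k"
  using comparable[OF assms(1,2)] assms(3) unfolding strictly_less_def
  by (metis less_imp_le not_less order_refl)

lemma eq_of_coordinate: "x \<in> \<Gamma> \<Longrightarrow> y \<in> \<Gamma> \<Longrightarrow> x i = y i \<Longrightarrow> x = y"
  using comparable unfolding strictly_less_def by (metis less_irrefl)

text \<open>Vertical integer shifts supply values at the site 0 on both sides of
  \<open>\<xi>\<close>, and connectedness fills the gap. Uniqueness is the strict order.\<close>

lemma ex1_point: "\<exists>!x. x \<in> \<Gamma> \<and> x 0 = \<xi>"
proof -
  obtain x where x: "x \<in> \<Gamma>" using ghost_circle by (auto simp: ghost_circle_def)
  let ?I = "(\<lambda>x. x 0) ` \<Gamma>"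
  have "connected ?I"
    by (intro connected_continuous_image continuous_on_subset[OF continuous_on_product_coordinates])
      (use ghost_circle in \<open>auto simp: ghost_circle_def\<close>)
  moreover have "x 0 + real_of_int \<lfloor>\<xi> - x 0\<rfloor> \<in> ?I"
    by (rule image_eqI[OF _ tau_in[OF x, of 0 "\<lfloor>\<xi> - x 0\<rfloor>"]]) (simp add: tau_def)
  moreover have "x 0 + real_of_int \<lceil>\<xi> - x 0\<rceil> \<in> ?I"
    by (rule image_eqI[OF _ tau_in[OF x, of 0 "\<lceil>\<xi> - x 0\<rceil>"]]) (simp add: tau_def)
  moreover have "x 0 + real_of_int \<lfloor>\<xi> - x 0\<rfloor> \<le> \<xi>" "\<xi> \<le> x 0 + real_of_int \<lceil>\<xi> - x 0\<rceil>"
    by linarith+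
  ultimately have "\<xi> \<in> ?I" by (meson connectedD_interval)
  then show ?thesis using eq_of_coordinate by blast
qed

lemma gc_point_in: "gc_point \<Gamma> \<xi> \<in> \<Gamma>" and gc_point_0: "gc_point \<Gamma> \<xi> 0 = \<xi>"
  using theI'[OF ex1_point] unfolding gc_point_def by auto

lemma obtain_trajectory:
  assumes "x \<in> \<Gamma>"
  obtains \<gamma> where "flow_solution r S x \<gamma>" "\<And>t. \<gamma> t \<in> \<Gamma>" "\<gamma> 0 = x"
  using ghost_circle assms unfolding ghost_circle_def flow_invariant_def
  by (metis flow_solution_def)

text \<open>To reverse their order the trajectories would have to agree at the site \<open>i\<close>
  at some intermediate time. Inside a circle this means that they coincide at that time, hence
  always by uniqueness. The sign of \<open>t\<close> does not matter.\<close>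

lemma trajectories_ordered:
  assumes \<gamma>: "flow_solution r S x \<gamma>" "\<And>t. \<gamma> t \<in> \<Gamma>"
    and \<eta>: "flow_solution r S y \<eta>" "\<And>t. \<eta> t \<in> \<Gamma>"
    and le: "\<gamma> 0 i \<le> \<eta> 0 i"
  shows "\<gamma> t k \<le> \<eta> t k"
proof (cases "\<gamma> t i \<le> \<eta> t i")
  case True
  with le_of_coordinate \<gamma>(2) \<eta>(2) show ?thesis by blast
next
  case False
  have "\<exists>s\<in>closed_segment 0 t. \<gamma> s i - \<eta> s i = 0"
  proof -
    have "connected ((\<lambda>s. \<gamma> s i - \<eta> s i) ` closed_segment 0 t)"
      by (intro connected_continuous_image continuous_on_diff flow_solution_continuous[OF \<gamma>(1)]
          flow_solution_continuous[OF \<eta>(1)] connected_segment)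
    from connectedD_interval[OF this, of "\<gamma> 0 i - \<eta> 0 i" "\<gamma> t i - \<eta> t i" 0] le False
    have "0 \<in> (\<lambda>s. \<gamma> s i - \<eta> s i) ` closed_segment 0 t" by simp
    then show ?thesis by force
  qed
  then obtain s where "\<gamma> s i = \<eta> s i" by auto
  then have "\<gamma> s = \<eta> s" using eq_of_coordinate \<gamma>(2) \<eta>(2) by blast
  then have "\<gamma> = \<eta>" by (rule flow_solution_unique[OF \<gamma>(1) \<eta>(1)])
  then show ?thesis by simp
qed

text \<open>If \<open>tau i l x\<close> lies above \<open>x\<close>, iterating the shift gives \<open>x 0 \<le> x (n * i) + n * l\<close>,
  so \<open>- l \<le> lpair \<omega> i\<close>; roundings of \<open>x 0 - x i\<close> serve as \<open>l\<close>, and similarly from above.\<close>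

lemma rotation_bound:
  assumes x: "x \<in> \<Gamma>" and rot: "has_rotation_vector x \<omega>"
  shows "\<bar>x i - x 0 - lpair \<omega> i\<bar> \<le> 1"
proof -
  have lim: "(\<lambda>n. x (int n *s i) / real n) \<longlonglongrightarrow> lpair \<omega> i"
    using rot by (simp add: has_rotation_vector_def)
  have c0: "(\<lambda>n. x 0 / real n) \<longlonglongrightarrow> 0" by (rule lim_const_over_n)
  have step: "x (int (Suc n) *s i) = x (int n *s i + i)" for n
    by (simp add: algebra_simps vec_eq_iff)
  define u where "u = \<lceil>x 0 - x i\<rceil>"
  have u: "x k \<le> x (k + i) + u" for k
  proof -
    have "x 0 \<le> tau i u x 0" by (simp add: tau_def u_def) linarith
    from le_of_coordinate[OF x tau_in[OF x] this, of k] show ?thesis by (simp add: tau_def)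
  qed
  have Un: "x 0 \<le> x (int n *s i) + n * u" for n
  proof (induction n)
    case (Suc n)
    with u[of "int n *s i"] show ?case unfolding step by (simp add: algebra_simps)
  qed simp
  have U: "x 0 / real n - u \<le> x (int n *s i) / real n" if "n > 0" for n
    using divide_right_mono[OF Un[of n], of "real n"] that by (simp add: add_divide_distrib)
  have "0 - real_of_int u \<le> lpair \<omega> i"
    by (rule LIMSEQ_le[OF tendsto_diff[OF c0 tendsto_const] lim]) (use U in \<open>auto intro!: exI[of _ 1]\<close>)
  define l where "l = \<lfloor>x 0 - x i\<rfloor>"
  have l: "x (k + i) + l \<le> x k" for k
  proof -
    have "tau i l x 0 \<le> x 0" by (simp add: tau_def l_def) linarith
    from le_of_coordinate[OF tau_in[OF x] x this, of k] show ?thesis by (simp add: tau_def)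
  qed
  have Ln: "x (int n *s i) + n * l \<le> x 0" for n
  proof (induction n)
    case (Suc n)
    with l[of "int n *s i"] show ?case unfolding step by (simp add: algebra_simps)
  qed simp
  have L: "x (int n *s i) / real n \<le> x 0 / real n - l" if "n > 0" for n
    using divide_right_mono[OF Ln[of n], of "real n"] that by (simp add: add_divide_distrib)
  have "lpair \<omega> i \<le> 0 - real_of_int l"
    by (rule LIMSEQ_le[OF lim tendsto_diff[OF c0 tendsto_const]]) (use L in \<open>auto intro!: exI[of _ 1]\<close>)
  with \<open>0 - real_of_int u \<le> lpair \<omega> i\<close> show ?thesis
    unfolding u_def l_def by linarith
qed

end

lemma abs_lpair_le: "\<bar>lpair \<omega> i\<bar> \<le> norm \<omega> * lnorm i"
proof -
  have "\<bar>lpair \<omega> i\<bar> \<le> (\<Sum>k\<in>UNIV. \<bar>\<omega> $ k * i $ k\<bar>)"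
    unfolding lpair_def by (rule sum_abs)
  also have "\<dots> \<le> (\<Sum>k\<in>UNIV. norm \<omega> * \<bar>i $ k\<bar>)"
    by (intro sum_mono) (simp add: abs_mult component_le_norm_cart mult_right_mono)
  finally show ?thesis by (simp add: lnorm_def sum_distrib_left)
qed

subsection \<open>Compactness\<close>

text \<open>Tychonoff's theorem; countability of the index set makes the product first countable, so
  that compactness yields subsequences.\<close>

lemma pointwise_convergent_subsequence:
  fixes f :: "nat \<Rightarrow> 'a::countable \<Rightarrow> real"
  assumes "\<And>n a. \<bar>f n a\<bar> \<le> B a"
  obtains \<phi> where "strict_mono \<phi>" "\<And>a. convergent (\<lambda>n. f (\<phi> n) a)"
proof -
  have "compactin (product_topology (\<lambda>_. euclidean) UNIV) (PiE UNIV (\<lambda>a. {- B a..B a}))"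
    by (subst compactin_PiE) auto
  then have "compact (PiE UNIV (\<lambda>a. {- B a..B a}))"
    by (simp add: euclidean_product_topology)
  then have "seq_compact (PiE UNIV (\<lambda>a. {- B a..B a}))"
    by (rule compact_imp_seq_compact)
  moreover have "\<forall>n. f n \<in> PiE UNIV (\<lambda>a. {- B a..B a})"
    using assms by (auto simp: abs_le_iff minus_le_iff)
  ultimately obtain g \<phi> where "strict_mono \<phi>" "(f \<circ> \<phi>) \<longlonglongrightarrow> g"
    unfolding seq_compact_def by blast
  moreover from this(2) have "(\<lambda>n. f (\<phi> n) a) \<longlonglongrightarrow> g a" for a
    using continuous_on_tendsto_compose[OF continuous_on_product_coordinates] by (fastforce simp: comp_def)
  ultimately show ?thesis using that convergentI by blast
qed

text \<open>A subsequence converging at all pairs of an index and a rational time exists by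
  compactness; equicontinuity for large \<open>n\<close> carries convergence to real times. The
  index \<open>a\<close> lets all sites share one subsequence.\<close>

lemma equicontinuous_convergent_subsequence:
  fixes f :: "nat \<Rightarrow> 'a::countable \<Rightarrow> real \<Rightarrow> real"
  assumes bound: "\<And>n a t. \<bar>f n a t\<bar> \<le> B a t"
    and equi: "\<And>a e. 0 < e \<Longrightarrow> \<exists>d>0. \<exists>N. \<forall>n\<ge>N. \<forall>s t. \<bar>s - t\<bar> < d \<longrightarrow> \<bar>f n a s - f n a t\<bar> < e"
  obtains \<phi> where "strict_mono \<phi>" "\<And>a t. convergent (\<lambda>n. f (\<phi> n) a t)"
proof -
  obtain \<phi> where \<phi>: "strict_mono \<phi>"
    "\<And>p :: 'a \<times> rat. convergent (\<lambda>n. f (\<phi> n) (fst p) (of_rat (snd p)))"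
  proof (rule pointwise_convergent_subsequence[of
        "\<lambda>n (p :: 'a \<times> rat). f n (fst p) (of_rat (snd p))" "\<lambda>p. B (fst p) (of_rat (snd p))"])
    show "\<bar>f n (fst p) (of_rat (snd p))\<bar> \<le> B (fst p) (of_rat (snd p))" for n and p :: "'a \<times> rat"
      by (rule bound)
  qed (rule that)
  show ?thesis
  proof (rule that[OF \<phi>(1)])
    fix a t
    have "Cauchy (\<lambda>n. f (\<phi> n) a t)"
    proof (rule metric_CauchyI)
      fix e :: real assume "0 < e"
      then have "0 < e / 3" by simp
      then obtain d N where d: "0 < d"
        "\<And>n s t. N \<le> n \<Longrightarrow> \<bar>s - t\<bar> < d \<Longrightarrow> \<bar>f n a s - f n a t\<bar> < e / 3"
        using equi[of "e / 3" a] by metis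
      obtain q where "t < of_rat q" "of_rat q < t + d"
        using of_rat_dense[of t "t + d"] d(1) by auto
      then have q: "\<bar>t - of_rat q\<bar> < d" by linarith
      have "Cauchy (\<lambda>n. f (\<phi> n) a (of_rat q))"
        using \<phi>(2)[of "(a, q)"] by (simp add: convergent_Cauchy)
      from metric_CauchyD[OF this \<open>0 < e / 3\<close>] obtain M where M: "\<And>m n. M \<le> m \<Longrightarrow> M \<le> n \<Longrightarrow>
          \<bar>f (\<phi> m) a (of_rat q) - f (\<phi> n) a (of_rat q)\<bar> < e / 3"
        unfolding dist_real_def by metis
      have "dist (f (\<phi> m) a t) (f (\<phi> n) a t) < e" if "max M N \<le> m" "max M N \<le> n" for m n
      proof -
        have "N \<le> \<phi> m" "N \<le> \<phi> n"
          using that seq_suble[OF \<phi>(1), of m] seq_suble[OF \<phi>(1), of n] by auto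
        from d(2)[OF this(1) q] d(2)[OF this(2) q] M[of m n] that show ?thesis
          unfolding dist_real_def by linarith
      qed
      then show "\<exists>M. \<forall>m\<ge>M. \<forall>n\<ge>M. dist (f (\<phi> m) a t) (f (\<phi> n) a t) < e" by blast
    qed
    then show "convergent (\<lambda>n. f (\<phi> n) a t)" by (rule Cauchy_convergent)
  qed
qed

subsection \<open>Sequences of ghost circles\<close>

text \<open>Nothing is assumed about the growth of \<open>Cn\<close>. Closeness is recorded only for
  first partials, uniformly in the sites and the configuration.\<close>

locale circle_sequence = lim: potentials r Sinf C
  for r :: real and Sinf :: "'d::finite site \<Rightarrow> 'd config \<Rightarrow> real" and C :: real +
  fixes S :: "nat \<Rightarrow> 'd site \<Rightarrow> 'd config \<Rightarrow> real" and Cn :: "nat \<Rightarrow> real"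
    and \<Gamma> :: "nat \<Rightarrow> 'd config set"
    and \<omega> :: "nat \<Rightarrow> real ^ 'd" and \<omega>inf :: "real ^ 'd" and \<epsilon> :: "nat \<Rightarrow> real"
  assumes potentials_n: "potentials r (S n) (Cn n)"
    and ghost_circle_n: "ghost_circle r (S n) (\<Gamma> n)"
    and rotation_n: "x \<in> \<Gamma> n \<Longrightarrow> has_rotation_vector x (\<omega> n)"
    and rotation_tendsto: "\<omega> \<longlonglongrightarrow> \<omega>inf"
    and pd_close: "\<bar>pd i (S n j) x - pd i (Sinf j) x\<bar> \<le> \<epsilon> n"
    and eps_tendsto: "\<epsilon> \<longlonglongrightarrow> 0"
begin

sublocale circ: circle r "S n" "Cn n" "\<Gamma> n" for n
  by (intro circle.intro circle_axioms.intro potentials_n ghost_circle_n)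

text \<open>Monotonicity of \<open>\<phi>\<close> is not asked for: the indices chosen in
  \<open>equicontinuous\<close> only satisfy \<open>k \<le> \<phi> k\<close>.\<close>

lemma reindex:
  assumes "filterlim \<phi> at_top sequentially"
  shows "circle_sequence r Sinf C (\<lambda>n. S (\<phi> n)) (\<lambda>n. Cn (\<phi> n)) (\<lambda>n. \<Gamma> (\<phi> n))
    (\<lambda>n. \<omega> (\<phi> n)) \<omega>inf (\<lambda>n. \<epsilon> (\<phi> n))"
  using filterlim_compose[OF rotation_tendsto assms] filterlim_compose[OF eps_tendsto assms]
  by (intro circle_sequence.intro circle_sequence_axioms.intro lim.potentials_axioms
      potentials_n ghost_circle_n rotation_n pd_close)

definition slope :: real where
  "slope = (SOME K. \<forall>n. norm (\<omega> n) \<le> K)"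

lemma norm_rotation_le: "norm (\<omega> n) \<le> slope"
proof -
  have "\<exists>K. \<forall>n. norm (\<omega> n) \<le> K"
    using Bseq_conv_Bfun convergent_imp_Bseq[OF convergentI[OF rotation_tendsto]]
    by (metis BseqE)
  from someI_ex[OF this] show ?thesis by (simp add: slope_def)
qed

lemma slope_nonneg: "0 \<le> slope"
  using norm_rotation_le[of 0] norm_ge_zero[of "\<omega> 0"] by linarith

lemma growth:
  assumes "x \<in> \<Gamma> n"
  shows "\<bar>x i - x 0\<bar> \<le> 1 + slope * lnorm i"
proof -
  have "norm (\<omega> n) * lnorm i \<le> slope * lnorm i"
    by (intro mult_right_mono norm_rotation_le) simp
  then show ?thesis
    using circ.rotation_bound[OF assms rotation_n[OF assms], of i] abs_lpair_le[of "\<omega> n" i]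
    by linarith
qed

definition ball_card :: real where
  "ball_card = real (card (lball (0 :: 'd site) r))"

lemma gradW_close: "\<bar>gradW r (S n) x i - gradW r Sinf x i\<bar> \<le> ball_card * \<epsilon> n"
proof -
  have "\<bar>gradW r (S n) x i - gradW r Sinf x i\<bar>
      \<le> (\<Sum>j\<in>lball i r. \<bar>pd i (S n j) x - pd i (Sinf j) x\<bar>)"
    unfolding gradW_def sum_subtractf[symmetric] by (rule sum_abs)
  also have "\<dots> \<le> real (card (lball i r)) * \<epsilon> n"
    by (rule sum_bounded_above) (rule pd_close)
  finally show ?thesis by (simp only: ball_card_def card_lball[of i])
qed

lemma tendsto_gradW_n:
  assumes "\<And>i. (\<lambda>n. x n i) \<longlonglongrightarrow> y i"
  shows "(\<lambda>n. gradW r (S n) (x n) i) \<longlonglongrightarrow> gradW r Sinf y i"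
proof -
  have "(\<lambda>n. gradW r (S n) (x n) i - gradW r Sinf (x n) i) \<longlonglongrightarrow> 0"
  proof (rule Lim_null_comparison)
    show "\<forall>\<^sub>F n in sequentially. norm (gradW r (S n) (x n) i - gradW r Sinf (x n) i) \<le> ball_card * \<epsilon> n"
      by (simp add: gradW_close)
    show "(\<lambda>n. ball_card * \<epsilon> n) \<longlonglongrightarrow> 0"
      by (rule tendsto_mult_right_zero[OF eps_tendsto])
  qed
  from tendsto_add[OF this lim.tendsto_gradW[of x y i, OF assms]] show ?thesis by simp
qed

text \<open>By shift invariance it suffices to bound the gradient at the site \<open>0\<close> of configurations
  with \<open>x 0\<close> in the unit interval.\<close>

lemma gradW_bounded: "\<exists>M. \<forall>n. \<forall>x\<in>\<Gamma> n. \<forall>i. \<bar>gradW r (S n) x i\<bar> \<le> M"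
proof -
  obtain E where E: "\<And>n. norm (\<epsilon> n) \<le> E"
    using convergent_imp_Bseq[OF convergentI[OF eps_tendsto]] by (metis BseqE)
  \<comment> \<open>Bounds the normalised configuration on all sites that enter the gradient at 0:
    at most 1 at the site 0, plus the growth \<open>1 + slope * (2 * r)\<close>.\<close>
  define a where "a = 2 + slope * (2 * r)"
  define M where "M = ball_card * E + \<bar>gradW r Sinf (\<lambda>_. 0) 0\<bar> + lim.lip * a"
  have "\<bar>gradW r (S n) x i\<bar> \<le> M" if x: "x \<in> \<Gamma> n" for n x i
  proof -
    define z where "z = tau i (- \<lfloor>x i\<rfloor>) x"
    have z: "z \<in> \<Gamma> n" using x by (simp add: z_def circ.tau_in)
    have "\<bar>z 0\<bar> \<le> 1" unfolding z_def tau_def by simp linarith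
    have za: "\<bar>z k - 0\<bar> \<le> a" if "lnorm (k - 0) \<le> 2 * r" for k
    proof -
      have "slope * lnorm k \<le> slope * (2 * r)"
        using that slope_nonneg by (intro mult_left_mono) auto
      with growth[OF z, of k] \<open>\<bar>z 0\<bar> \<le> 1\<close> show ?thesis
        unfolding a_def by linarith
    qed
    have "\<bar>gradW r Sinf z 0 - gradW r Sinf (\<lambda>_. 0) 0\<bar> \<le> lim.lip * a"
      by (rule order_trans[OF lim.gradW_lipschitz lim.double_ball_sum_le]) (rule za)
    moreover have "\<bar>gradW r (S n) z 0 - gradW r Sinf z 0\<bar> \<le> ball_card * E"
    proof (rule order_trans[OF gradW_close])
      show "ball_card * \<epsilon> n \<le> ball_card * E"
        using E[of n] by (intro mult_left_mono) (auto simp: ball_card_def)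
    qed
    moreover have "gradW r (S n) x i = gradW r (S n) z 0"
      by (simp add: z_def circ.gradW_tau)
    ultimately show ?thesis unfolding M_def by linarith
  qed
  then show ?thesis by blast
qed

definition speed :: real where
  "speed = (SOME M. \<forall>n. \<forall>x\<in>\<Gamma> n. \<forall>i. \<bar>gradW r (S n) x i\<bar> \<le> M)"

lemma gradW_le_speed: "x \<in> \<Gamma> n \<Longrightarrow> \<bar>gradW r (S n) x i\<bar> \<le> speed"
  using someI_ex[OF gradW_bounded] unfolding speed_def by blast

lemma trajectory_lipschitz:
  assumes \<gamma>: "flow_solution r (S n) x \<gamma>" and "\<And>t. \<gamma> t \<in> \<Gamma> n"
  shows "\<bar>\<gamma> s i - \<gamma> t i\<bar> \<le> speed * \<bar>s - t\<bar>"
proof (rule field_differentiable_bound[of "UNIV :: real set", unfolded real_norm_def])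
  show "((\<lambda>t. \<gamma> t i) has_field_derivative - gradW r (S n) (\<gamma> u) i) (at u within UNIV)" for u
    using circ.flow_solution_has_derivative[OF \<gamma>] by simp
  show "\<bar>- gradW r (S n) (\<gamma> u) i\<bar> \<le> speed" for u
    using gradW_le_speed[OF assms(2)] by simp
qed auto

text \<open>Up to an error from \<open>\<epsilon> n\<close> the remainder is quadratic in
  \<open>s - t\<close>, uniformly in \<open>n\<close> and the site. The factor 2 arises because the
  gradients at both times are replaced by those of \<open>Sinf\<close> before the Lipschitz bound is
  applied.\<close>

lemma trajectory_remainder:
  assumes \<gamma>: "flow_solution r (S n) x \<gamma>" and \<gamma>_in: "\<And>t. \<gamma> t \<in> \<Gamma> n"
  shows "\<bar>\<gamma> s i - \<gamma> t i + (s - t) * gradW r (S n) (\<gamma> t) i\<bar>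
    \<le> (2 * ball_card * \<epsilon> n + lim.lip * (speed * \<bar>s - t\<bar>)) * \<bar>s - t\<bar>"
proof -
  let ?g = "gradW r (S n) (\<gamma> t) i"
  have sp: "0 \<le> speed" using gradW_le_speed[OF \<gamma>_in[of 0], of 0] by linarith
  have "\<bar>(\<gamma> s i + s * ?g) - (\<gamma> t i + t * ?g)\<bar>
      \<le> (2 * ball_card * \<epsilon> n + lim.lip * (speed * \<bar>s - t\<bar>)) * \<bar>s - t\<bar>"
  proof (rule field_differentiable_bound[of "closed_segment t s", unfolded real_norm_def])
    show "((\<lambda>u. \<gamma> u i + u * ?g) has_field_derivative - gradW r (S n) (\<gamma> u) i + ?g)
        (at u within closed_segment t s)" for u
      using circ.flow_solution_has_derivative[OF \<gamma>, of i u]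
      by (auto intro!: derivative_eq_intros dest: has_field_derivative_at_within)
    fix u assume "u \<in> closed_segment t s"
    then have u: "\<bar>u - t\<bar> \<le> \<bar>s - t\<bar>" by (auto simp: closed_segment_eq_real_ivl split: if_splits)
    have "\<bar>\<gamma> u k - \<gamma> t k\<bar> \<le> speed * \<bar>s - t\<bar>" for k
      using trajectory_lipschitz[OF \<gamma> \<gamma>_in, of u k t] mult_left_mono[OF u sp] by linarith
    then have "\<bar>gradW r Sinf (\<gamma> u) i - gradW r Sinf (\<gamma> t) i\<bar> \<le> lim.lip * (speed * \<bar>s - t\<bar>)"
      by (rule lim.gradW_lipschitz_sup)
    with gradW_close[of n "\<gamma> u" i] gradW_close[of n "\<gamma> t" i]
    show "\<bar>- gradW r (S n) (\<gamma> u) i + ?g\<bar> \<le> 2 * ball_card * \<epsilon> n + lim.lip * (speed * \<bar>s - t\<bar>)"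
      by linarith
  qed auto
  then show ?thesis by (simp add: algebra_simps)
qed

lemma growth_limit:
  assumes "\<And>n. x n \<in> \<Gamma> n" and "\<And>i. (\<lambda>n. x n i) \<longlonglongrightarrow> y i"
  shows "\<bar>y i - y 0 - lpair \<omega>inf i\<bar> \<le> 1"
proof (rule LIMSEQ_le_const2)
  have "(\<lambda>n. lpair (\<omega> n) i) \<longlonglongrightarrow> lpair \<omega>inf i"
    unfolding lpair_def by (intro tendsto_intros rotation_tendsto)
  then show "(\<lambda>n. \<bar>x n i - x n 0 - lpair (\<omega> n) i\<bar>) \<longlonglongrightarrow> \<bar>y i - y 0 - lpair \<omega>inf i\<bar>"
    by (intro tendsto_intros assms)
  show "\<exists>N. \<forall>n\<ge>N. \<bar>x n i - x n 0 - lpair (\<omega> n) i\<bar> \<le> 1"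
    using circ.rotation_bound[OF assms(1) rotation_n[OF assms(1)]] by blast
qed

lemma limit_in_Xspace:
  assumes "\<And>n. x n \<in> \<Gamma> n" and "\<And>i. (\<lambda>n. x n i) \<longlonglongrightarrow> y i"
  shows "y \<in> Xspace"
proof (rule Xspace_linear_growth)
  fix i
  show "\<bar>y i\<bar> \<le> (\<bar>y 0\<bar> + 1) + norm \<omega>inf * lnorm i"
    using growth_limit[OF assms, of i] abs_lpair_le[of \<omega>inf i] by linarith
qed

text \<open>Pointwise convergence alone would not give differentiability in X. The remainder
  estimate does: in the limit it is quadratic in \<open>s - t\<close>, uniformly over the sites, so
  \<open>Xnorm_le_sup\<close> applies.\<close>

lemma limit_flow_solution:
  assumes \<gamma>n: "\<And>n. flow_solution r (S n) (x n) (\<gamma>n n)" and in_\<Gamma>: "\<And>n t. \<gamma>n n t \<in> \<Gamma> n"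
    and conv: "\<And>t i. (\<lambda>n. \<gamma>n n t i) \<longlonglongrightarrow> \<gamma> t i"
  shows "flow_solution r Sinf (\<gamma> 0) \<gamma>"
  unfolding flow_solution_def
proof (intro conjI allI)
  show "\<gamma> t \<in> Xspace" for t
    by (rule limit_in_Xspace[OF in_\<Gamma> conv])
  fix t
  have rem: "\<bar>\<gamma> s i - \<gamma> t i + (s - t) * gradW r Sinf (\<gamma> t) i\<bar> \<le> lim.lip * (speed * \<bar>s - t\<bar>) * \<bar>s - t\<bar>"
    for s i
  proof (rule LIMSEQ_le)
    show "(\<lambda>n. \<bar>\<gamma>n n s i - \<gamma>n n t i + (s - t) * gradW r (S n) (\<gamma>n n t) i\<bar>)
        \<longlonglongrightarrow> \<bar>\<gamma> s i - \<gamma> t i + (s - t) * gradW r Sinf (\<gamma> t) i\<bar>"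
      by (intro tendsto_intros conv tendsto_gradW_n)
    have "(\<lambda>n. (2 * ball_card * \<epsilon> n + lim.lip * (speed * \<bar>s - t\<bar>)) * \<bar>s - t\<bar>)
        \<longlonglongrightarrow> (2 * ball_card * 0 + lim.lip * (speed * \<bar>s - t\<bar>)) * \<bar>s - t\<bar>"
      by (intro tendsto_intros eps_tendsto)
    then show "(\<lambda>n. (2 * ball_card * \<epsilon> n + lim.lip * (speed * \<bar>s - t\<bar>)) * \<bar>s - t\<bar>)
        \<longlonglongrightarrow> lim.lip * (speed * \<bar>s - t\<bar>) * \<bar>s - t\<bar>" by simp
  qed (use trajectory_remainder[OF \<gamma>n in_\<Gamma>] in blast)
  let ?c = "lim.lip * speed * Xnorm (\<lambda>i :: 'd site. 1)"
  show "((\<lambda>s. Xnorm (\<lambda>i. \<gamma> s i - \<gamma> t i + (s - t) * gradW r Sinf (\<gamma> t) i) / \<bar>s - t\<bar>) \<longlongrightarrow> 0) (at t)"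
  proof (rule Lim_null_comparison, intro always_eventually allI)
    fix s
    \<comment> \<open>At \<open>s = t\<close> the quotient is 0 by the convention on division by
      zero.\<close>
    show "norm (Xnorm (\<lambda>i. \<gamma> s i - \<gamma> t i + (s - t) * gradW r Sinf (\<gamma> t) i) / \<bar>s - t\<bar>) \<le> ?c * \<bar>s - t\<bar>"
      using Xnorm_le_sup[OF rem, of s] Xnorm_nonneg[of "\<lambda>i. \<gamma> s i - \<gamma> t i + (s - t) * gradW r Sinf (\<gamma> t) i"]
      by (cases "s = t") (simp_all add: abs_of_nonneg divide_le_eq mult_ac)
    have "((\<lambda>s. ?c * \<bar>s - t\<bar>) \<longlongrightarrow> ?c * \<bar>t - t\<bar>) (at t)"
      by (intro tendsto_intros)
    then show "((\<lambda>s. ?c * \<bar>s - t\<bar>) \<longlongrightarrow> 0) (at t)" by simp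
  qed
qed simp

text \<open>The index \<open>b\<close> allows several families of trajectories to converge along the
  same subsequence: two for comparing limits, one for building a limit trajectory.\<close>

lemma trajectories_subsequence:
  fixes \<gamma> :: "'b::countable \<Rightarrow> nat \<Rightarrow> real \<Rightarrow> 'd config"
  assumes \<gamma>: "\<And>b n. flow_solution r (S n) (x b n) (\<gamma> b n)" and in_\<Gamma>: "\<And>b n t. \<gamma> b n t \<in> \<Gamma> n"
    and conv: "\<And>b i. convergent (\<lambda>n. \<gamma> b n 0 i)"
  obtains \<phi> where "strict_mono \<phi>" "\<And>b t i. convergent (\<lambda>n. \<gamma> b (\<phi> n) t i)"
proof -
  have sp: "0 \<le> speed" using gradW_le_speed[OF in_\<Gamma>[of undefined 0 0], of 0] by linarith
  have "\<exists>K. \<forall>n. \<bar>\<gamma> b n 0 i\<bar> \<le> K" for b i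
    using convergent_imp_Bseq[OF conv[of b i]] by (metis BseqE real_norm_def)
  then obtain K where K: "\<And>b i n. \<bar>\<gamma> b n 0 i\<bar> \<le> K b i" by metis
  obtain \<phi> where \<phi>: "strict_mono \<phi>"
    "\<And>a t. convergent (\<lambda>n. \<gamma> (fst a) (\<phi> n) t (snd a))"
  proof (rule equicontinuous_convergent_subsequence[of "\<lambda>n a t. \<gamma> (fst a) n t (snd a)"
        "\<lambda>a t. K (fst a) (snd a) + speed * \<bar>t\<bar>"])
    fix n t and a :: "'b \<times> 'd site"
    show "\<bar>\<gamma> (fst a) n t (snd a)\<bar> \<le> K (fst a) (snd a) + speed * \<bar>t\<bar>"
      using trajectory_lipschitz[OF \<gamma> in_\<Gamma>, of "fst a" n t "snd a" 0] K[where b = "fst a" and n = n and i = "snd a"]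
      by simp
  next
    fix a :: "'b \<times> 'd site" and e :: real assume e: "0 < e"
    have "\<bar>\<gamma> (fst a) n s (snd a) - \<gamma> (fst a) n t (snd a)\<bar> < e"
      if "\<bar>s - t\<bar> < e / (speed + 1)" for n s t
    proof -
      have "speed * \<bar>s - t\<bar> \<le> (speed + 1) * \<bar>s - t\<bar>" by (simp add: mult_right_mono)
      also have "\<dots> < e" using that sp by (simp add: pos_less_divide_eq mult.commute)
      finally show ?thesis
        using trajectory_lipschitz[OF \<gamma> in_\<Gamma>, of "fst a" n s "snd a" t] by linarith
    qed
    moreover have "0 < e / (speed + 1)" using e sp by simp
    ultimately show "\<exists>d>0. \<exists>N. \<forall>n\<ge>N. \<forall>s t. \<bar>s - t\<bar> < d \<longrightarrow>
        \<bar>\<gamma> (fst a) n s (snd a) - \<gamma> (fst a) n t (snd a)\<bar> < e" by blast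
  qed (rule that)
  show ?thesis
    using that[OF \<phi>(1)] \<phi>(2)[of "(_, _)"] by simp
qed

text \<open>The limits \<open>\<gamma> \<le> \<eta>\<close> of ordered trajectories are ordered for all times, also negative ones.
  Where they touch at time \<open>0\<close>, the difference \<open>\<eta> - \<gamma>\<close> has a minimum in time, so the gradients
  agree there, and the twist condition makes them touch at all neighbouring sites.\<close>

lemma ordered_limits_eq:
  assumes x: "\<And>n. x n \<in> \<Gamma> n" and y: "\<And>n. y n \<in> \<Gamma> n" and le: "\<And>n. x n 0 \<le> y n 0"
    and xlim: "\<And>i. (\<lambda>n. x n i) \<longlonglongrightarrow> xl i" and ylim: "\<And>i. (\<lambda>n. y n i) \<longlonglongrightarrow> yl i"
    and touch: "xl i0 = yl i0"
  shows "xl = yl"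
proof -
  define z where "z b n = (if b then x n else y n)" for b n
  \<comment> \<open>Any solution will do: \<open>flow_invariant\<close> keeps every trajectory that
    starts in the circle inside it.\<close>
  define \<gamma> where "\<gamma> b n = (SOME \<gamma>. flow_solution r (S n) (z b n) \<gamma>)" for b n
  have z: "z b n \<in> \<Gamma> n" for b n
    using x y by (simp add: z_def)
  have \<gamma>: "flow_solution r (S n) (z b n) (\<gamma> b n)" "\<gamma> b n t \<in> \<Gamma> n" "\<gamma> b n 0 = z b n" for b n t
  proof -
    have "\<exists>\<gamma>. flow_solution r (S n) (z b n) \<gamma>"
      using circ.obtain_trajectory[OF z] by blast
    then show sol: "flow_solution r (S n) (z b n) (\<gamma> b n)"
      unfolding \<gamma>_def by (rule someI_ex)
    then show "\<gamma> b n 0 = z b n" by (simp add: flow_solution_def)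
    from sol show "\<gamma> b n t \<in> \<Gamma> n"
      using ghost_circle_n[of n] z[of b n] by (simp add: ghost_circle_def flow_invariant_def)
  qed
  have zlim: "(\<lambda>n. z b n i) \<longlonglongrightarrow> (if b then xl i else yl i)" for b i
    using xlim ylim by (cases b) (simp_all add: z_def)
  have "convergent (\<lambda>n. \<gamma> b n 0 i)" for b i
    unfolding \<gamma>(3) by (rule convergentI[OF zlim])
  then obtain \<phi> where \<phi>: "strict_mono \<phi>" "\<And>b t i. convergent (\<lambda>n. \<gamma> b (\<phi> n) t i)"
    by (rule trajectories_subsequence[of z \<gamma>, OF \<gamma>(1,2)]) (rule that)
  define \<gamma>l where "\<gamma>l b t i = lim (\<lambda>n. \<gamma> b (\<phi> n) t i)" for b t i
  have \<gamma>l: "(\<lambda>n. \<gamma> b (\<phi> n) t i) \<longlonglongrightarrow> \<gamma>l b t i" for b t i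
    unfolding \<gamma>l_def using \<phi>(2) by (simp add: convergent_LIMSEQ_iff)
  interpret sub: circle_sequence r Sinf C "\<lambda>n. S (\<phi> n)" "\<lambda>n. Cn (\<phi> n)" "\<lambda>n. \<Gamma> (\<phi> n)"
    "\<lambda>n. \<omega> (\<phi> n)" \<omega>inf "\<lambda>n. \<epsilon> (\<phi> n)"
    by (rule reindex[OF filterlim_subseq[OF \<phi>(1)]])
  have sol: "flow_solution r Sinf (\<gamma>l b 0) (\<gamma>l b)" for b
    by (rule sub.limit_flow_solution[OF \<gamma>(1,2) \<gamma>l])
  have start: "\<gamma>l b 0 i = (if b then xl i else yl i)" for b i
    using LIMSEQ_unique[OF \<gamma>l[of b 0 i], unfolded \<gamma>(3), OF LIMSEQ_subseq_LIMSEQ[OF zlim \<phi>(1), unfolded comp_def]] .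
  have ordered: "\<gamma>l True t i \<le> \<gamma>l False t i" for t i
  proof (rule LIMSEQ_le[OF \<gamma>l \<gamma>l], intro exI allI impI)
    fix n
    show "\<gamma> True (\<phi> n) t i \<le> \<gamma> False (\<phi> n) t i"
      by (rule circ.trajectories_ordered[OF \<gamma>(1,2) \<gamma>(1,2), where i = 0])
        (simp add: \<gamma>(3) z_def le)
  qed
  have "\<gamma>l True 0 = \<gamma>l False 0"
  proof (rule lim.gradW_eq_imp_eq)
    show "\<gamma>l True 0 k \<le> \<gamma>l False 0 k" for k by (rule ordered)
    show "\<gamma>l True 0 i0 = \<gamma>l False 0 i0" using touch by (simp add: start)
    fix i assume eq: "\<gamma>l True 0 i = \<gamma>l False 0 i"
    have "((\<lambda>t. \<gamma>l False t i - \<gamma>l True t i) has_real_derivative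
        - gradW r Sinf (\<gamma>l False 0) i - - gradW r Sinf (\<gamma>l True 0) i) (at 0)"
      by (rule DERIV_diff; rule lim.flow_solution_has_derivative, rule sol)
    then have "- gradW r Sinf (\<gamma>l False 0) i - - gradW r Sinf (\<gamma>l True 0) i = 0"
      by (rule DERIV_local_min[of _ _ _ 1]) (use ordered eq in auto)
    then show "gradW r Sinf (\<gamma>l True 0) i = gradW r Sinf (\<gamma>l False 0) i" by simp
  qed
  then show ?thesis using start[of True] start[of False] by (auto simp: fun_eq_iff)
qed

text \<open>The order of \<open>x n\<close> and \<open>y n\<close> may change with \<open>n\<close>,
  but one of the two orders occurs infinitely often. Pass to those indices, exchanging the roles of
  the sequences if necessary.\<close>

lemma limits_eq:
  assumes \<phi>: "filterlim \<phi> at_top sequentially"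
    and x: "\<And>n. x n \<in> \<Gamma> (\<phi> n)" and y: "\<And>n. y n \<in> \<Gamma> (\<phi> n)"
    and xlim: "\<And>i. (\<lambda>n. x n i) \<longlonglongrightarrow> xl i" and ylim: "\<And>i. (\<lambda>n. y n i) \<longlonglongrightarrow> yl i"
    and touch: "xl i0 = yl i0"
  shows "xl = yl"
proof -
  have *: "xl = yl"
    if x: "\<And>n. x n \<in> \<Gamma> (\<phi> n)" and y: "\<And>n. y n \<in> \<Gamma> (\<phi> n)"
      and xlim: "\<And>i. (\<lambda>n. x n i) \<longlonglongrightarrow> xl i" and ylim: "\<And>i. (\<lambda>n. y n i) \<longlonglongrightarrow> yl i"
      and touch: "xl i0 = yl i0" and inf: "infinite {n. x n 0 \<le> y n 0}" for x y xl yl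
  proof -
    define \<psi> where "\<psi> = enumerate {n. x n 0 \<le> y n 0}"
    have \<psi>: "strict_mono \<psi>" unfolding \<psi>_def by (rule strict_mono_enumerate[OF inf])
    have le: "x (\<psi> n) 0 \<le> y (\<psi> n) 0" for n
      using enumerate_in_set[OF inf, of n] by (simp add: \<psi>_def)
    interpret sub: circle_sequence r Sinf C "\<lambda>n. S (\<phi> (\<psi> n))" "\<lambda>n. Cn (\<phi> (\<psi> n))" "\<lambda>n. \<Gamma> (\<phi> (\<psi> n))"
      "\<lambda>n. \<omega> (\<phi> (\<psi> n))" \<omega>inf "\<lambda>n. \<epsilon> (\<phi> (\<psi> n))"
      by (rule reindex[OF filterlim_compose[OF \<phi> filterlim_subseq[OF \<psi>]]])
    show ?thesis
      by (rule sub.ordered_limits_eq[OF x y le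
            LIMSEQ_subseq_LIMSEQ[OF xlim \<psi>, unfolded comp_def]
            LIMSEQ_subseq_LIMSEQ[OF ylim \<psi>, unfolded comp_def] touch])
  qed
  show ?thesis
  proof (cases "infinite {n. x n 0 \<le> y n 0}")
    case True
    from *[OF x y xlim ylim touch True] show ?thesis .
  next
    case False
    then have "infinite {n. y n 0 \<le> x n 0}"
      using infinite_UNIV_nat finite_UnI[of "{n. x n 0 \<le> y n 0}" "{n. y n 0 \<le> x n 0}"]
      by (metis (mono_tags, lifting) UNIV_eq_I UnCI linear mem_Collect_eq)
    from *[OF y x ylim xlim touch[symmetric] this] show ?thesis by simp
  qed
qed

text \<open>Otherwise circles of ever larger index contain pairs that approach each other at the
  site 0 but stay \<open>e\<close> apart at \<open>i\<close>. Their limits agree at 0, hence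
  everywhere by \<open>limits_eq\<close>.\<close>

lemma equicontinuous:
  assumes "0 < e"
  shows "\<exists>d>0. \<exists>N. \<forall>n\<ge>N. \<forall>x\<in>\<Gamma> n. \<forall>y\<in>\<Gamma> n. \<bar>x 0 - y 0\<bar> < d \<longrightarrow> \<bar>x i - y i\<bar> < e"
proof (rule ccontr)
  assume neg: "\<not> ?thesis"
  have "\<exists>n x y. k \<le> n \<and> x \<in> \<Gamma> n \<and> y \<in> \<Gamma> n \<and> \<bar>x 0 - y 0\<bar> < inverse (real (Suc k)) \<and> e \<le> \<bar>x i - y i\<bar>" for k
  proof -
    have "0 < inverse (real (Suc k))" by simp
    with neg show ?thesis by (metis not_le)
  qed
  then obtain \<phi> x y where \<phi>: "\<And>k. k \<le> \<phi> k" and x: "\<And>k. x k \<in> \<Gamma> (\<phi> k)" and y: "\<And>k. y k \<in> \<Gamma> (\<phi> k)"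
    and close: "\<And>k. \<bar>x k 0 - y k 0\<bar> < inverse (real (Suc k))" and far: "\<And>k. e \<le> \<bar>x k i - y k i\<bar>"
    by metis
  \<comment> \<open>Both members are shifted by the same integer, taken from \<open>x k\<close>:
    differences are preserved and the values at 0 become bounded.\<close>
  define z where "z b k = tau 0 (- \<lfloor>x k 0\<rfloor>) (if b then x k else y k)" for b k
  have z: "z b k \<in> \<Gamma> (\<phi> k)" for b k
    using x y by (simp add: z_def circ.tau_in)
  have z0: "\<bar>z b k 0\<bar> \<le> 2" for b k
  proof -
    have "inverse (real (Suc k)) \<le> 1" by (simp add: field_simps)
    with close[of k] show ?thesis unfolding z_def tau_def by (cases b) (simp_all, linarith+)
  qed
  obtain \<psi> where \<psi>: "strict_mono \<psi>" "\<And>a. convergent (\<lambda>n. z (fst a) (\<psi> n) (snd a))"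
  proof (rule pointwise_convergent_subsequence[of "\<lambda>k a. z (fst a) k (snd a)"
        "\<lambda>a. 3 + slope * lnorm (snd a)"])
    show "\<bar>z (fst a) k (snd a)\<bar> \<le> 3 + slope * lnorm (snd a)" for k and a :: "bool \<times> 'd site"
      using growth[OF z, of "fst a" k "snd a"] z0[of "fst a" k] by linarith
  qed (rule that)
  define zl where "zl b j = lim (\<lambda>n. z b (\<psi> n) j)" for b j
  have zl: "(\<lambda>n. z b (\<psi> n) j) \<longlonglongrightarrow> zl b j" for b j
    unfolding zl_def using \<psi>(2)[of "(b, j)"] by (simp add: convergent_LIMSEQ_iff)
  have "filterlim \<phi> at_top sequentially"
    by (rule filterlim_at_top_mono[OF filterlim_ident]) (simp add: \<phi>)
  then have flim: "filterlim (\<lambda>n. \<phi> (\<psi> n)) at_top sequentially"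
    by (rule filterlim_compose[OF _ filterlim_subseq[OF \<psi>(1)]])
  have diff: "z True k j - z False k j = x k j - y k j" for k j
    by (simp add: z_def tau_def)
  have "(\<lambda>n. z True (\<psi> n) 0 - z False (\<psi> n) 0) \<longlonglongrightarrow> 0"
  proof (rule Lim_null_comparison)
    show "\<forall>\<^sub>F n in sequentially. norm (z True (\<psi> n) 0 - z False (\<psi> n) 0) \<le> inverse (real (Suc (\<psi> n)))"
      using close by (simp add: diff less_imp_le)
    show "(\<lambda>n. inverse (real (Suc (\<psi> n)))) \<longlonglongrightarrow> 0"
      using LIMSEQ_subseq_LIMSEQ[OF LIMSEQ_inverse_real_of_nat \<psi>(1)] by (simp add: comp_def)
  qed
  with tendsto_diff[OF zl[of True 0] zl[of False 0]] have "zl True 0 = zl False 0"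
    using LIMSEQ_unique by fastforce
  from limits_eq[OF flim z z zl zl this] have "zl True = zl False" .
  moreover have "e \<le> \<bar>zl True i - zl False i\<bar>"
    by (rule LIMSEQ_le_const[OF tendsto_rabs[OF tendsto_diff[OF zl zl]]]) (use far in \<open>auto simp: diff\<close>)
  ultimately show False using assms by simp
qed

lemma points_subsequence:
  obtains \<phi> where "strict_mono \<phi>" "\<And>i \<xi>. convergent (\<lambda>n. gc_point (\<Gamma> (\<phi> n)) \<xi> i)"
proof (rule equicontinuous_convergent_subsequence[of "\<lambda>n i \<xi>. gc_point (\<Gamma> n) \<xi> i"
      "\<lambda>i \<xi>. \<bar>\<xi>\<bar> + 1 + slope * lnorm i"])
  show "\<bar>gc_point (\<Gamma> n) \<xi> i\<bar> \<le> \<bar>\<xi>\<bar> + 1 + slope * lnorm i" for n \<xi> and i :: "'d site"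
    using growth[OF circ.gc_point_in, of n \<xi> i] by (simp add: circ.gc_point_0)
  fix i :: "'d site" and e :: real assume "0 < e"
  from equicontinuous[OF this, of i]
  show "\<exists>d>0. \<exists>N. \<forall>n\<ge>N. \<forall>\<xi> \<eta>. \<bar>\<xi> - \<eta>\<bar> < d \<longrightarrow> \<bar>gc_point (\<Gamma> n) \<xi> i - gc_point (\<Gamma> n) \<eta> i\<bar> < e"
    using circ.gc_point_in circ.gc_point_0 by metis
qed (rule that)

end

subsection \<open>The limit circle\<close>

locale convergent_circles = circle_sequence +
  fixes X :: "real \<Rightarrow> 'a config"
  assumes points_tendsto: "\<And>\<xi> i. (\<lambda>n. gc_point (\<Gamma> n) \<xi> i) \<longlonglongrightarrow> X \<xi> i"
begin

lemma X_0: "X \<xi> 0 = \<xi>"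
  using LIMSEQ_unique[OF points_tendsto[of \<xi> 0]] by (simp add: circ.gc_point_0)

lemma gc_point_range: "gc_point (range X) \<xi> = X \<xi>"
  unfolding gc_point_def by (rule the_equality) (auto simp: X_0)

text \<open>The limit touches \<open>X (yl 0)\<close> at the site 0, so \<open>limits_eq\<close>
  identifies the two. Shift invariance, flow invariance and the limit minimizer are all obtained
  from this.\<close>

lemma limit_in_range:
  assumes "filterlim \<phi> at_top sequentially" "\<And>n. y n \<in> \<Gamma> (\<phi> n)" "\<And>i. (\<lambda>n. y n i) \<longlonglongrightarrow> yl i"
  shows "yl = X (yl 0)"
  by (rule limits_eq[OF assms(1,2) circ.gc_point_in assms(3), where ?i0.0 = 0])
    (auto simp: X_0 intro: filterlim_compose[OF points_tendsto assms(1)])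

lemma X_mono: "\<xi> \<le> \<eta> \<Longrightarrow> X \<xi> i \<le> X \<eta> i"
proof (rule LIMSEQ_le[OF points_tendsto points_tendsto], intro exI allI impI)
  fix n
  assume le: "\<xi> \<le> \<eta>"
  show "gc_point (\<Gamma> n) \<xi> i \<le> gc_point (\<Gamma> n) \<eta> i"
    by (rule circ.le_of_coordinate[OF circ.gc_point_in circ.gc_point_in, where i = 0])
      (simp add: circ.gc_point_0 le)
qed

lemma X_strict: "\<xi> < \<eta> \<Longrightarrow> X \<xi> \<lless> X \<eta>"
proof -
  assume less: "\<xi> < \<eta>"
  have "X \<xi> i \<noteq> X \<eta> i" for i
  proof
    assume "X \<xi> i = X \<eta> i"
    from limits_eq[OF filterlim_ident circ.gc_point_in circ.gc_point_in points_tendsto points_tendsto this]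
    have "X \<xi> = X \<eta>" .
    with X_0[of \<xi>] X_0[of \<eta>] less show False by simp
  qed
  with X_mono[of \<xi> \<eta>] less show ?thesis by (simp add: strictly_less_def less_le)
qed

lemma X_continuous: "continuous_on UNIV (\<lambda>\<xi>. X \<xi> i)"
proof (clarsimp simp: continuous_on_iff dist_real_def)
  fix \<xi> e :: real assume "0 < e"
  \<comment> \<open>Strict inequalities become weak in the limit.\<close>
  then have "0 < e / 2" by simp
  from equicontinuous[OF this, of i] obtain d N where d: "0 < d"
    "\<And>n x y. N \<le> n \<Longrightarrow> x \<in> \<Gamma> n \<Longrightarrow> y \<in> \<Gamma> n \<Longrightarrow> \<bar>x 0 - y 0\<bar> < d \<Longrightarrow> \<bar>x i - y i\<bar> < e / 2"
    by metis
  have "\<bar>X \<eta> i - X \<xi> i\<bar> < e" if "\<bar>\<eta> - \<xi>\<bar> < d" for \<eta>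
  proof -
    have "\<bar>X \<eta> i - X \<xi> i\<bar> \<le> e / 2"
      by (rule LIMSEQ_le_const2[OF tendsto_rabs[OF tendsto_diff[OF points_tendsto points_tendsto]]])
        (use d(2)[OF _ circ.gc_point_in circ.gc_point_in] that in
          \<open>auto simp: circ.gc_point_0 intro!: exI[of _ N] less_imp_le\<close>)
    with \<open>0 < e\<close> show ?thesis by linarith
  qed
  with d(1) show "\<exists>d>0. \<forall>\<eta>. \<bar>\<eta> - \<xi>\<bar> < d \<longrightarrow> \<bar>X \<eta> i - X \<xi> i\<bar> < e" by blast
qed

text \<open>The trajectories through the approximating points
  \<open>gc_point (\<Gamma> n) \<xi>\<close> converge along a subsequence. At each time their limit
  is a limit of circle elements, hence in the range of \<open>X\<close>.\<close>

lemma limit_trajectory: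
  obtains \<gamma> where "flow_solution r Sinf (X \<xi>) \<gamma>" "\<And>t. \<gamma> t \<in> range X"
proof -
  define \<gamma>n where "\<gamma>n n = (SOME \<gamma>. flow_solution r (S n) (gc_point (\<Gamma> n) \<xi>) \<gamma>)" for n
  have sol: "flow_solution r (S n) (gc_point (\<Gamma> n) \<xi>) (\<gamma>n n)" for n
  proof -
    have "\<exists>\<gamma>. flow_solution r (S n) (gc_point (\<Gamma> n) \<xi>) \<gamma>"
      using circ.obtain_trajectory[OF circ.gc_point_in] by blast
    then show ?thesis unfolding \<gamma>n_def by (rule someI_ex)
  qed
  have start: "\<gamma>n n 0 = gc_point (\<Gamma> n) \<xi>" for n
    using sol[of n] by (simp add: flow_solution_def)
  have in_\<Gamma>: "\<gamma>n n t \<in> \<Gamma> n" for n t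
    using ghost_circle_n[of n] circ.gc_point_in[of n \<xi>] sol[of n]
    by (simp add: ghost_circle_def flow_invariant_def)
  have "convergent (\<lambda>n. \<gamma>n n 0 i)" for i
    unfolding start by (rule convergentI[OF points_tendsto])
  then obtain \<phi> where \<phi>: "strict_mono \<phi>" "\<And>(b :: unit) t i. convergent (\<lambda>n. \<gamma>n (\<phi> n) t i)"
    by (rule trajectories_subsequence[of "\<lambda>(_ :: unit) n. gc_point (\<Gamma> n) \<xi>" "\<lambda>_. \<gamma>n", OF sol in_\<Gamma>])
      (rule that)
  define \<gamma> where "\<gamma> t i = lim (\<lambda>n. \<gamma>n (\<phi> n) t i)" for t i
  have conv: "(\<lambda>n. \<gamma>n (\<phi> n) t i) \<longlonglongrightarrow> \<gamma> t i" for t i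
    unfolding \<gamma>_def using \<phi>(2) by (simp add: convergent_LIMSEQ_iff)
  interpret sub: circle_sequence r Sinf C "\<lambda>n. S (\<phi> n)" "\<lambda>n. Cn (\<phi> n)" "\<lambda>n. \<Gamma> (\<phi> n)"
    "\<lambda>n. \<omega> (\<phi> n)" \<omega>inf "\<lambda>n. \<epsilon> (\<phi> n)"
    by (rule reindex[OF filterlim_subseq[OF \<phi>(1)]])
  have "\<gamma> 0 = X \<xi>"
  proof
    fix i
    show "\<gamma> 0 i = X \<xi> i"
      by (rule LIMSEQ_unique[OF conv[of 0 i, unfolded start]
            LIMSEQ_subseq_LIMSEQ[OF points_tendsto \<phi>(1), unfolded comp_def]])
  qed
  with sub.limit_flow_solution[OF sol in_\<Gamma> conv] have "flow_solution r Sinf (X \<xi>) \<gamma>" by simp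
  moreover have "\<gamma> t \<in> range X" for t
    using limit_in_range[OF filterlim_subseq[OF \<phi>(1)] in_\<Gamma> conv] by (metis rangeI)
  ultimately show ?thesis by (rule that)
qed

lemma ghost_circle_limit: "ghost_circle r Sinf (range X)"
  unfolding ghost_circle_def
proof (intro conjI ballI allI)
  show "closed (range X)"
  proof -
    \<comment> \<open>The range is a graph over the coordinate at 0; continuity of \<open>X\<close>
      makes each defining equation a closed condition.\<close>
    have "range X = (\<Inter>i. {x. x i = X (x 0) i})"
      by (auto simp: X_0 fun_eq_iff image_iff)
    moreover have "closed {x :: 'a config. x i = X (x 0) i}" for i
      by (intro closed_Collect_eq continuous_on_product_coordinates
          continuous_on_compose2[OF X_continuous]) auto
    ultimately show ?thesis by auto
  qed
  show "connected (range X)"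
    by (intro connected_continuous_image continuous_on_coordinatewise_then_product X_continuous
        connected_UNIV)
  fix x assume "x \<in> range X"
  then obtain \<xi> where x: "x = X \<xi>" by auto
  show "x \<lless> y \<or> x = y \<or> y \<lless> x" if "y \<in> range X" for y
    using that X_strict unfolding x by (metis imageE linorder_less_linear)
  show "tau k l x \<in> range X" for k l
  proof -
    have "tau k l x = X (tau k l x 0)"
    proof (rule limit_in_range[OF filterlim_ident])
      show "tau k l (gc_point (\<Gamma> n) \<xi>) \<in> \<Gamma> n" for n
        by (rule circ.tau_in[OF circ.gc_point_in])
      show "(\<lambda>n. tau k l (gc_point (\<Gamma> n) \<xi>) i) \<longlonglongrightarrow> tau k l x i" for i
        unfolding tau_def x by (intro tendsto_intros points_tendsto)
    qed
    then show ?thesis by (metis rangeI)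
  qed
next
  show "flow_invariant r Sinf (range X)"
    unfolding flow_invariant_def
  proof (intro conjI subsetI ballI allI impI)
    fix x assume "x \<in> range X"
    then obtain \<xi> where x: "x = X \<xi>" by auto
    obtain \<gamma> where "flow_solution r Sinf (X \<xi>) \<gamma>" "\<And>t. \<gamma> t \<in> range X"
      by (rule limit_trajectory[of \<xi>]) (rule that)
    then have \<gamma>: "flow_solution r Sinf x \<gamma>" "\<gamma> t \<in> range X" for t
      by (simp_all add: x)
    show "\<exists>\<gamma>. flow_solution r Sinf x \<gamma>" using \<gamma>(1) by blast
    show "x \<in> Xspace" unfolding x by (rule limit_in_Xspace[OF circ.gc_point_in points_tendsto])
    fix \<eta> t assume \<eta>: "flow_solution r Sinf x \<eta>"
    \<comment> \<open>An arbitrary trajectory must be identified with the constructed one.\<close>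
    have "\<eta> = \<gamma>"
      by (rule lim.flow_solution_unique[OF \<eta> \<gamma>(1), of 0])
        (use \<eta> \<gamma>(1) in \<open>simp add: flow_solution_def\<close>)
    with \<gamma>(2) show "\<eta> t \<in> range X" by simp
  qed
qed simp

text \<open>The distance to the line of slope \<open>\<omega>inf\<close> is at most 1 at every site,
  so it vanishes after division by \<open>n\<close>.\<close>

lemma has_rotation_vector_limit: "has_rotation_vector (X \<xi>) \<omega>inf"
  unfolding has_rotation_vector_def
proof
  fix i
  have "(\<lambda>n. X \<xi> (int n *s i) / real n - lpair \<omega>inf i) \<longlonglongrightarrow> 0"
  proof (rule Lim_null_comparison)
    show "\<forall>\<^sub>F n in sequentially. norm (X \<xi> (int n *s i) / real n - lpair \<omega>inf i) \<le> (1 + \<bar>\<xi>\<bar>) / real n"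
    proof (rule eventually_sequentiallyI)
      fix n :: nat assume n: "1 \<le> n"
      have "lpair \<omega>inf (int n *s i) = n * lpair \<omega>inf i"
        by (simp add: lpair_def sum_distrib_left mult_ac)
      then have "\<bar>X \<xi> (int n *s i) - n * lpair \<omega>inf i\<bar> \<le> 1 + \<bar>\<xi>\<bar>"
        using growth_limit[OF circ.gc_point_in points_tendsto, of \<xi> "int n *s i"] X_0[of \<xi>] by linarith
      moreover have "X \<xi> (int n *s i) / real n - lpair \<omega>inf i = (X \<xi> (int n *s i) - n * lpair \<omega>inf i) / n"
        using n by (simp add: field_simps)
      ultimately show "norm (X \<xi> (int n *s i) / real n - lpair \<omega>inf i) \<le> (1 + \<bar>\<xi>\<bar>) / real n"
        by (simp add: abs_divide divide_right_mono)
    qed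
    show "(\<lambda>n. (1 + \<bar>\<xi>\<bar>) / real n) \<longlonglongrightarrow> 0" by (rule lim_const_over_n)
  qed
  then show "(\<lambda>n. X \<xi> (int n *s i) / real n) \<longlonglongrightarrow> lpair \<omega>inf i"
    by (rule LIM_zero_cancel)
qed

end

section \<open>Minimizers in the limit\<close>

text \<open>Minimality compares \<open>S j (x + y)\<close> with \<open>S j x\<close>; such differences are controlled by the
  gradients alone.\<close>

lemma (in circle_sequence) tendsto_potential_increment:
  fixes y :: "'d config"
  assumes xlim: "\<And>i. (\<lambda>n. x n i) \<longlonglongrightarrow> xl i"
  shows "(\<lambda>n. S n j (\<lambda>i. x n i + y i) - S n j (x n)) \<longlonglongrightarrow> Sinf j (\<lambda>i. xl i + y i) - Sinf j xl"
proof -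
  let ?F = "\<lambda>n z. S n j z - Sinf j z"
  have "(\<lambda>n. ?F n (\<lambda>i. x n i + y i) - ?F n (x n)) \<longlonglongrightarrow> 0"
  proof (rule Lim_null_comparison, intro always_eventually allI)
    fix n
    \<comment> \<open>The mean value estimate is applied to the difference of the two potentials,
      whose first partials are at most \<open>\<epsilon> n\<close> everywhere.\<close>
    have "\<bar>?F n (mix (lball j r) (x n) (\<lambda>i. x n i + y i)) - ?F n (x n)\<bar>
        \<le> \<epsilon> n * (\<Sum>k\<in>lball j r. \<bar>(x n k + y k) - x n k\<bar>)"
    proof (rule finite_coordinates_mvt)
      show "(\<lambda>t. ?F n (z(i := z i + t))) differentiable (at 0)" for i z
        by (intro differentiable_diff circ.potential_differentiable lim.potential_differentiable)
      fix k z
      have "((\<lambda>t. ?F n (z(k := z k + t))) has_real_derivative pd k (S n j) z - pd k (Sinf j) z) (at 0)"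
        unfolding pd_def
        by (intro DERIV_diff; simp only: DERIV_deriv_iff_real_differentiable
            circ.potential_differentiable lim.potential_differentiable)
      then have "pd k (?F n) z = pd k (S n j) z - pd k (Sinf j) z"
        unfolding pd_def by (rule DERIV_imp_deriv)
      then show "\<bar>pd k (?F n) z\<bar> \<le> \<epsilon> n" by (simp add: pd_close)
    qed simp
    moreover have "?F n (mix (lball j r) (x n) (\<lambda>i. x n i + y i)) = ?F n (\<lambda>i. x n i + y i)"
      by (intro arg_cong2[of _ _ _ _ minus] circ.potential_cong lim.potential_cong) (auto simp: mix_def)
    ultimately show "norm (?F n (\<lambda>i. x n i + y i) - ?F n (x n)) \<le> \<epsilon> n * (\<Sum>k\<in>lball j r. \<bar>y k\<bar>)"
      by simp
  next
    show "(\<lambda>n. \<epsilon> n * (\<Sum>k\<in>lball j r. \<bar>y k\<bar>)) \<longlonglongrightarrow> 0"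
      by (rule tendsto_mult_left_zero[OF eps_tendsto])
  qed
  moreover have "(\<lambda>n. Sinf j (\<lambda>i. x n i + y i) - Sinf j (x n)) \<longlonglongrightarrow> Sinf j (\<lambda>i. xl i + y i) - Sinf j xl"
    by (intro tendsto_diff lim.tendsto_potential xlim tendsto_add tendsto_const)
  ultimately show ?thesis
    using tendsto_add[of "\<lambda>n. ?F n (\<lambda>i. x n i + y i) - ?F n (x n)" 0 sequentially] by fastforce
qed

lemma (in circle_sequence) global_minimizer_limit:
  assumes min: "\<And>n. global_minimizer r (S n) (x n)" and xlim: "\<And>i. (\<lambda>n. x n i) \<longlonglongrightarrow> xl i"
  shows "global_minimizer r Sinf xl"
  unfolding global_minimizer_def
proof (intro allI impI)
  fix B :: "'d site set" and y :: "'d config"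
  assume B: "finite B" and y: "\<forall>i. i \<notin> {i \<in> B. lball i r \<subseteq> B} \<longrightarrow> y i = 0"
  have "0 \<le> W_B Sinf B (\<lambda>i. xl i + y i) - W_B Sinf B xl"
  proof (rule LIMSEQ_le_const)
    show "(\<lambda>n. W_B (S n) B (\<lambda>i. x n i + y i) - W_B (S n) B (x n))
        \<longlonglongrightarrow> W_B Sinf B (\<lambda>i. xl i + y i) - W_B Sinf B xl"
      unfolding W_B_def sum_subtractf[symmetric]
      by (intro tendsto_sum tendsto_potential_increment xlim)
    show "\<exists>N. \<forall>n\<ge>N. 0 \<le> W_B (S n) B (\<lambda>i. x n i + y i) - W_B (S n) B (x n)"
      using min B y unfolding global_minimizer_def by (auto simp: algebra_simps)
  qed
  then show "W_B Sinf B xl \<le> W_B Sinf B (\<lambda>i. xl i + y i)" by simp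
qed

lemma (in convergent_circles) range_contains_global_minimizer:
  assumes "\<And>n. \<exists>x\<in>\<Gamma> n. global_minimizer r (S n) x"
  shows "\<exists>x\<in>range X. global_minimizer r Sinf x"
proof -
  obtain x where x: "\<And>n. x n \<in> \<Gamma> n" "\<And>n. global_minimizer r (S n) (x n)"
    using assms by metis
  \<comment> \<open>The given minimizers may be arbitrarily high or low; integer shifts keep
    minimality and make the values at 0 bounded.\<close>
  define z where "z n = tau 0 (- \<lfloor>x n 0\<rfloor>) (x n)" for n
  have z: "z n \<in> \<Gamma> n" "global_minimizer r (S n) (z n)" for n
    using x by (simp_all add: z_def circ.tau_in circ.global_minimizer_tau)
  have z0: "\<bar>z n 0\<bar> \<le> 1" for n
    unfolding z_def tau_def by simp linarith
  obtain \<phi> where \<phi>: "strict_mono \<phi>" "\<And>i. convergent (\<lambda>n. z (\<phi> n) i)"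
  proof (rule pointwise_convergent_subsequence[of z "\<lambda>i. 2 + slope * lnorm i"])
    show "\<bar>z n i\<bar> \<le> 2 + slope * lnorm i" for n i
      using growth[OF z(1), of n i] z0[of n] by linarith
  qed (rule that)
  define zl where "zl i = lim (\<lambda>n. z (\<phi> n) i)" for i
  have zl: "(\<lambda>n. z (\<phi> n) i) \<longlonglongrightarrow> zl i" for i
    unfolding zl_def using \<phi>(2) by (simp add: convergent_LIMSEQ_iff)
  interpret sub: circle_sequence r Sinf C "\<lambda>n. S (\<phi> n)" "\<lambda>n. Cn (\<phi> n)" "\<lambda>n. \<Gamma> (\<phi> n)"
    "\<lambda>n. \<omega> (\<phi> n)" \<omega>inf "\<lambda>n. \<epsilon> (\<phi> n)"
    by (rule reindex[OF filterlim_subseq[OF \<phi>(1)]])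
  have "global_minimizer r Sinf zl"
    by (rule sub.global_minimizer_limit[OF z(2) zl])
  moreover have "zl \<in> range X"
    using limit_in_range[OF filterlim_subseq[OF \<phi>(1)] z(1) zl] by (metis rangeI)
  ultimately show ?thesis by blast
qed

section \<open>From the gradient norm to uniform bounds, and the theorem\<close>

lemma pd_le_C1_grad_norm:
  assumes "i \<in> B" "finite B"
  shows "ereal \<bar>pd i F x\<bar> \<le> C1_grad_norm B F"
proof -
  have nonneg: "0 \<le> (SUP x. ereal \<bar>f x\<bar>)" for f :: "'a config \<Rightarrow> real"
    by (rule SUP_upper2[of undefined]) auto
  have "ereal \<bar>pd i F x\<bar> \<le> (SUP x. ereal \<bar>pd i F x\<bar>)"
    by (rule SUP_upper) simp
  also have "\<dots> \<le> (\<Sum>j\<in>B. SUP x. ereal \<bar>pd j F x\<bar>)"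
    unfolding sum.remove[OF assms(2,1)] by (intro add_increasing2 sum_nonneg nonneg order_refl)
  also have "\<dots> \<le> C1_grad_norm B F"
    unfolding C1_grad_norm_def by (intro add_increasing2 sum_nonneg nonneg) auto
  finally show ?thesis .
qed

text \<open>The shift by \<open>j\<close> reduces every potential to the one at site 0, to which the
  norm refers. Directions outside the ball are absent from the norm, but there both partials
  vanish.\<close>

lemma pd_close_of_C1_grad_norm:
  assumes S: "potentials r S C" and T: "potentials r T D"
    and norm: "C1_grad_norm (lball 0 r) (\<lambda>x. S 0 x - T 0 x) \<le> ereal e" and "0 \<le> e"
  shows "\<bar>pd i (S j) x - pd i (T j) x\<bar> \<le> e"
proof -
  interpret S: potentials r S C by (rule S)
  interpret T: potentials r T D by (rule T)
  let ?x = "tau j 0 x" and ?k = "i - j"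
  have shift: "pd i (S j) x = pd ?k (S 0) ?x" "pd i (T j) x = pd ?k (T 0) ?x"
    by (simp_all add: S.pd_tau T.pd_tau)
  show ?thesis
  proof (cases "?k \<in> lball 0 r")
    case True
    have "((\<lambda>t. S 0 (?x(?k := ?x ?k + t)) - T 0 (?x(?k := ?x ?k + t)))
        has_real_derivative pd ?k (S 0) ?x - pd ?k (T 0) ?x) (at 0)"
      unfolding pd_def
      by (intro DERIV_diff; simp only: DERIV_deriv_iff_real_differentiable
          S.potential_differentiable T.potential_differentiable)
    then have "pd ?k (\<lambda>x. S 0 x - T 0 x) ?x = pd ?k (S 0) ?x - pd ?k (T 0) ?x"
      by (subst pd_def) (rule DERIV_imp_deriv)
    then show ?thesis
      using order_trans[OF pd_le_C1_grad_norm[OF True finite_lball] norm, of ?x] by (simp add: shift)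
  next
    case False
    then show ?thesis using \<open>0 \<le> e\<close> by (simp add: shift S.pd_outside T.pd_outside)
  qed
qed

theorem mainTheorem16:
  fixes K :: "(real ^ 'd::finite) set"
    and \<omega> :: "nat \<Rightarrow> real ^ 'd" and \<omega>inf :: "real ^ 'd"
    and r :: real
    and S :: "nat \<Rightarrow> 'd site \<Rightarrow> 'd config \<Rightarrow> real"
    and Sinf :: "'d site \<Rightarrow> 'd config \<Rightarrow> real"
    and \<Gamma> :: "nat \<Rightarrow> 'd config set"
  assumes "compact K"
    and "\<And>n. \<omega> n \<in> K" and "\<omega>inf \<in> K" and "\<omega> \<longlonglongrightarrow> \<omega>inf"
    and "\<And>n. local_potentials r (S n)"
    and "local_potentials r Sinf"
    and "(\<lambda>n. C1_grad_norm (lball 0 r) (\<lambda>x. S n 0 x - Sinf 0 x)) \<longlonglongrightarrow> 0"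
    and "\<And>n. ghost_circle r (S n) (\<Gamma> n)"
    and "\<And>n. gc_rotation_vector (\<Gamma> n) (\<omega> n)"
  shows "\<exists>\<Gamma>inf nm. ghost_circle r Sinf \<Gamma>inf \<and> gc_rotation_vector \<Gamma>inf \<omega>inf \<and>
           strict_mono nm \<and> gc_converges (\<Gamma> \<circ> nm) \<Gamma>inf \<and>
           (((\<forall>j. uniform_limit (Birkhoff_set K) (\<lambda>n. S n j) (Sinf j) sequentially) \<and>
             (\<forall>n. \<exists>x\<in>\<Gamma> n. global_minimizer r (S n) x))
            \<longrightarrow> (\<exists>x\<in>\<Gamma>inf. global_minimizer r Sinf x))"
proof -
  obtain C where C: "potentials r Sinf C"
    using obtain_potentials[OF assms(6)] .
  have "\<exists>c. potentials r (S n) c" for n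
    using obtain_potentials[OF assms(5)] by blast
  then obtain Cn where Cn: "\<And>n. potentials r (S n) (Cn n)" by metis
  define \<delta> where "\<delta> n = C1_grad_norm (lball 0 r) (\<lambda>x. S n 0 x - Sinf 0 x)" for n
  have \<delta>: "\<delta> \<longlonglongrightarrow> 0" using assms(7) by (simp add: \<delta>_def[abs_def])
  have \<delta>_nonneg: "0 \<le> \<delta> n" for n
  proof -
    have "(0 :: 'd site) \<in> lball 0 r"
      using assms(6) by (intro center_in_lball) (simp add: local_potentials_def)
    from order_trans[OF _ pd_le_C1_grad_norm[OF this finite_lball]] show ?thesis
      unfolding \<delta>_def by (metis abs_ge_zero ereal_less_eq(5))
  qed
  \<comment> \<open>The norm is an extended real and may be infinite for finitely many
    \<open>n\<close>; these are discarded by the index shift \<open>N\<close>, so that real bounds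
    can be extracted.\<close>
  have "\<forall>\<^sub>F n in sequentially. \<delta> n < 1"
    using order_tendstoD(2)[OF \<delta>] by simp
  then obtain N where N: "\<And>n. N \<le> n \<Longrightarrow> \<delta> n < 1"
    unfolding eventually_sequentially by blast
  define \<epsilon> where "\<epsilon> n = real_of_ereal (\<delta> (n + N))" for n
  have \<epsilon>_ereal: "ereal (\<epsilon> n) = \<delta> (n + N)" for n
    using N[of "n + N"] \<delta>_nonneg[of "n + N"] unfolding \<epsilon>_def by (intro ereal_real') auto
  have shiftN: "filterlim (\<lambda>n. n + N) at_top sequentially"
    by (rule filterlim_add_const_nat_at_top)
  have "(\<lambda>n. ereal (\<epsilon> n)) \<longlonglongrightarrow> ereal 0"
    unfolding \<epsilon>_ereal using filterlim_compose[OF \<delta> shiftN] by (simp add: zero_ereal_def)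
  then have \<epsilon>: "\<epsilon> \<longlonglongrightarrow> 0" by simp
  have \<epsilon>_nonneg: "0 \<le> \<epsilon> n" for n
    using \<delta>_nonneg[of "n + N"] unfolding \<epsilon>_ereal[symmetric] by simp
  interpret seq: circle_sequence r Sinf C "\<lambda>n. S (n + N)" "\<lambda>n. Cn (n + N)" "\<lambda>n. \<Gamma> (n + N)"
    "\<lambda>n. \<omega> (n + N)" \<omega>inf \<epsilon>
  proof (intro circle_sequence.intro circle_sequence_axioms.intro C Cn assms(8) \<epsilon>)
    show "has_rotation_vector x (\<omega> (n + N))" if "x \<in> \<Gamma> (n + N)" for x n
      using assms(9)[of "n + N"] that by (simp add: gc_rotation_vector_def)
    show "(\<lambda>n. \<omega> (n + N)) \<longlonglongrightarrow> \<omega>inf" by (rule filterlim_compose[OF assms(4) shiftN])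
    show "\<bar>pd i (S (n + N) j) x - pd i (Sinf j) x\<bar> \<le> \<epsilon> n" for i n j x
      by (rule pd_close_of_C1_grad_norm[OF Cn C _ \<epsilon>_nonneg]) (simp add: \<epsilon>_ereal \<delta>_def)
  qed
  obtain \<phi> where \<phi>: "strict_mono \<phi>" "\<And>i \<xi>. convergent (\<lambda>n. gc_point (\<Gamma> (\<phi> n + N)) \<xi> i)"
    by (rule seq.points_subsequence) (rule that)
  define X where "X \<xi> i = lim (\<lambda>n. gc_point (\<Gamma> (\<phi> n + N)) \<xi> i)" for \<xi> i
  interpret conv: convergent_circles r Sinf C "\<lambda>n. S (\<phi> n + N)" "\<lambda>n. Cn (\<phi> n + N)"
    "\<lambda>n. \<Gamma> (\<phi> n + N)" "\<lambda>n. \<omega> (\<phi> n + N)" \<omega>inf "\<lambda>n. \<epsilon> (\<phi> n)" X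
  proof (intro convergent_circles.intro convergent_circles_axioms.intro)
    show "circle_sequence r Sinf C (\<lambda>n. S (\<phi> n + N)) (\<lambda>n. Cn (\<phi> n + N)) (\<lambda>n. \<Gamma> (\<phi> n + N))
        (\<lambda>n. \<omega> (\<phi> n + N)) \<omega>inf (\<lambda>n. \<epsilon> (\<phi> n))"
      by (rule seq.reindex[OF filterlim_subseq[OF \<phi>(1)]])
    show "(\<lambda>n. gc_point (\<Gamma> (\<phi> n + N)) \<xi> i) \<longlonglongrightarrow> X \<xi> i" for \<xi> i
      unfolding X_def using \<phi>(2) by (simp add: convergent_LIMSEQ_iff)
  qed
  let ?nm = "\<lambda>n. \<phi> n + N"
  have "strict_mono ?nm" using \<phi>(1) by (simp add: strict_mono_def)
  moreover have "gc_rotation_vector (range X) \<omega>inf"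
    using conv.has_rotation_vector_limit by (auto simp: gc_rotation_vector_def)
  moreover have "gc_converges (\<Gamma> \<circ> ?nm) (range X)"
    using conv.points_tendsto by (simp add: gc_converges_def conv.gc_point_range)
  ultimately show ?thesis
    using conv.ghost_circle_limit conv.range_contains_global_minimizer
    by (intro exI[of _ "range X"] exI[of _ ?nm]) auto
qed

end
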